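(* Let $T=\mathbb{Z}$ or $T=\mathbb{R}$, $\alpha\in(0,2)$, and consider the following integral representations of (stationary S$\alpha$S) processes: (I) $\displaystyle\int_{\widehat T} e^{itx}N_\alpha(dx)$ in the complex-valued case, or $\displaystyle\int_{\{1\}}N_\alpha(dx)+n(t)\int_{\{2\}}N_\alpha(dx)$ in the real-valued case, where $N_\alpha$ has a finite control measure $\eta$; (II) $\displaystyle\int_Z\int_{[0,q(z))} b_1(z)^{[v+t]_{q(z)}}\,g(z,\{v+t\}_{q(z)})\,M_\alpha(dz,dv)$, where $(Z,\mathcal Z,\sigma)$ is a standard Lebesgue space, $q(z)\in T_+$ a.e. $\sigma(dz)$, $g\in L^\alpha(Z\times[0,q(\cdot)),\sigma(dz)\lambda(dv))$ and $b_1(z)\in\{-1,1\}$ (real-valued case) or $|b_1(z)|=1$ (complex-valued case) are measurable, and $M_\alpha$ has control measure $\sigma(dz)\lambda(dv)$; (I)+(II) the sum of the two with $N_\alpha$ and $M_\alpha$ independent, regarded as an integral representation on the disjoint union of the two underlying measure spaces. If the representation (I)+(II) (respectively (I), respectively (II)) of a process $X_\alpha$ is minimal, then $X_\alpha$ with this representation is generated by a unique flow (unique up to $\nu$-a.e. equality of $\phi_t$ for each $t\in T$, $\nu$ being the control measure on the underlying space). This flow is periodic for (I)+(II), identity for (I), and cyclic for (II). Moreover, the representation (I) is always minimal.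
   Context: Notation. $\lambda$ is counting measure on $\mathbb{Z}$ if $T=\mathbb{Z}$ and Lebesgue measure if $T=\mathbb{R}$. $\widehat T=\mathbb{R}$ if $T=\mathbb{R}$ and $\widehat T=[0,2\pi)$ if $T=\mathbb{Z}$. $n(t)=0$ if $T=\mathbb{R}$, $n(t)=(-1)^t$ if $T=\mathbb{Z}$. In the real-valued case of (I) the underlying space is $\{1,2\}$ if $T=\mathbb{Z}$, with kernel $f_t(1)=1$, $f_t(2)=(-1)^t$; if $T=\mathbb{R}$ the underlying space is $\{1\}$ (since $n\equiv0$). $T_+=(0,\infty)$ if $T=\mathbb{R}$, $T_+=\{2,3,\dots\}$ if $T=\mathbb{Z}$. For $a>0$, $x\in\mathbb{R}$: $[x]_a=\max\{n\in\mathbb{Z}:na\le x\}$, $\{x\}_a=x-a[x]_a$. $Z\times[0,q(\cdot))=\{(z,v):z\in Z,0\le v<q(z)\}$. A standard Lebesgue space is a standard Borel space with a $\sigma$-finite measure. Random measures are S$\alpha$S: real-valued, or complex-valued and rotationally invariant. A representation of a S$\alpha$S process is $\{X_\alpha(t)\}_{t\in T}\stackrel{d}{=}\{\int_Sf_t\,dM_\alpha\}_{t\in T}$ with $\{f_t\}\subset L^\alpha(S,\mathcal S,\nu)$, $(t,s)\mapsto f_t(s)$ measurable, $(S,\mathcal S,\nu)$ standard Lebesgue, and $\nu$ the control measure of $M_\alpha$. $\mathrm{supp}\{f_t,t\in T\}$ is the minimal (a.e.) set $A\in\mathcal S$ with $\nu\{s\notin A:f_t(s)\neq0\}=0$ for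 every $t\in T$. The representation $\{f_t\}$ is minimal if (M1) $\mathrm{supp}\{f_t,t\in T\}=S$ $\nu$-a.e., and (M2) $\sigma\{f_u/f_v:u,v\in T\}=\mathcal S$ modulo $\nu$ (ratios being extended-valued functions). A condition equivalent to (M2) is: for every nonsingular map $\phi:S\to S$ and every nowhere vanishing scalar function $h$ on $S$ such that for each $t\in T$, $f_t(s)=h(s)f_t(\phi(s))$ a.e. $\nu(ds)$, one has $\phi(s)=s$ a.e. $\nu(ds)$. Flows. A flow $\{\phi_t\}_{t\in T}$ on $(S,\mathcal S,\nu)$ is a family of maps $\phi_t:S\to S$ with $\phi_0(s)=s$, $\phi_{t_1+t_2}=\phi_{t_1}\circ\phi_{t_2}$; measurable if $(t,s)\mapsto\phi_t(s)$ is measurable; nonsingular if for every $t$, $\nu(N)=0\iff\nu(\phi_t^{-1}(N))=0$. A cocycle for it is a measurable $(t,s)\mapsto a_t(s)$ with $a_{t_1+t_2}(s)=a_{t_1}(s)a_{t_2}(\phi_{t_1}(s))$. With $P=\{s:\exists\,p\in T\setminus\{0\},\phi_p(s)=s\}$, $F=\{s:\phi_t(s)=s\ \forall t\in T\}$, $L=P\setminus F$, a measurable flow is periodic if $S=P$ $\nu$-a.e., identity if $S=F$ $\nu$-a.e., cyclic if $S=L$ $\nu$-a.e. Generated by a flow. A stationary S$\alpha$S process with representation $\{f_t\}$ is generated by a nonsingular measurable flow $\{\phi_t\}$ on $(S,\mathcal S,\nu)$ if for all $t\in T$, $f_t(s)=a_t(s)\{\frac{d(\nu\circ\phi_t)}{d\nu}(s)\}^{1/\alpha}f_0(\phi_t(s))$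 a.e. $\nu(ds)$, where $f_0\in L^\alpha(S,\mathcal S,\nu)$, $\{a_t\}$ is a cocycle for the flow with values in $\{-1,1\}$ (real-valued case) or $\{|w|=1\}$ (complex-valued case), and $\mathrm{supp}\{f_t,t\in T\}=S$ $\nu$-a.e. *)

theory Defs
  imports "HOL-Probability.Probability"
begin

text \<open>
  The index set \<open>T\<close> (the integers or the real line) is a subset of the type of reals, so both
  cases share all definitions below; time-indexed families are only ever looked at for times
  in \<open>T\<close>. The scalar type \<open>'b\<close> is meant to be \<open>real\<close> or \<open>complex\<close>; a scalar of norm one is
  then an element of \<open>{-1,1}\<close>, respectively of the unit circle.
\<close>

section \<open>Standard Lebesgue spaces\<close>

definition standard_borel :: "'s measure \<Rightarrow> bool" where
  "standard_borel S \<longleftrightarrow>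
     (\<exists>X. completely_metrizable_space X \<and> second_countable X \<and>
          topspace X = space S \<and> sets S = sigma_sets (space S) {U. openin X U})"

definition standard_lebesgue :: "'s measure \<Rightarrow> bool" where
  "standard_lebesgue S \<longleftrightarrow> standard_borel S \<and> sigma_finite_measure S"

section \<open>S\<open>\<alpha>\<close>S random measures, integrals and representations\<close>

definition in_L :: "real \<Rightarrow> 's measure \<Rightarrow> ('s \<Rightarrow> 'b::real_normed_vector) \<Rightarrow> bool" where
  "in_L \<alpha> S h \<longleftrightarrow> h \<in> borel_measurable S \<and> integrable S (\<lambda>s. norm (h s) powr \<alpha>)"

definition finite_sets :: "'s measure \<Rightarrow> 's set set" where
  "finite_sets S = {A \<in> sets S. emeasure S A < \<infinity>}"

text \<open>
  \<open>\<theta> \<bullet> x\<close> is the product for real scalars and \<open>Re (cnj \<theta> * x)\<close> for complex ones. Hence the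
  prescribed characteristic function is that of a symmetric, respectively of a rotationally
  invariant, \<open>\<alpha>\<close>-stable variable, normalised so that \<open>S\<close> is the control measure.
\<close>
definition sas_random_measure ::
  "real \<Rightarrow> 's measure \<Rightarrow> 'w measure \<Rightarrow>
   ('s set \<Rightarrow> 'w \<Rightarrow> 'b::{real_normed_field,euclidean_space}) \<Rightarrow> bool" where
  "sas_random_measure \<alpha> S Q M \<longleftrightarrow>
     prob_space Q \<and>
     (\<forall>A\<in>finite_sets S. M A \<in> borel_measurable Q) \<and>
     (\<forall>A\<in>finite_sets S. \<forall>\<theta>.
        (\<integral>\<omega>. cis (\<theta> \<bullet> M A \<omega>) \<partial>Q) = of_real (exp (- measure S A * norm \<theta> powr \<alpha>))) \<and>
     (\<forall>A::nat \<Rightarrow> 's set. range A \<subseteq> finite_sets S \<and> disjoint_family A \<longrightarrow>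
        prob_space.indep_vars Q (\<lambda>_. borel) (\<lambda>i. M (A i)) UNIV) \<and>
     (\<forall>A::nat \<Rightarrow> 's set. range A \<subseteq> finite_sets S \<and> disjoint_family A \<and>
        (\<Union>i. A i) \<in> finite_sets S \<longrightarrow>
        (AE \<omega> in Q. (\<lambda>i. M (A i) \<omega>) sums M (\<Union>i. A i) \<omega>))"

definition simple_stoch_integral ::
  "'s measure \<Rightarrow> ('s set \<Rightarrow> 'w \<Rightarrow> 'b) \<Rightarrow> ('s \<Rightarrow> 'b::real_normed_field) \<Rightarrow> 'w \<Rightarrow> 'b" where
  "simple_stoch_integral S M h \<omega> =
     (\<Sum>y \<in> h ` space S - {0}. y * M (h -` {y} \<inter> space S) \<omega>)"

text \<open>
  \<open>Y\<close> is (a version of) \<open>\<integral>h dM\<close>: the limit in probability of the integrals of simple functions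
  converging to \<open>h\<close> in \<open>L\<^sup>\<alpha>\<close>.
\<close>
definition is_stoch_integral ::
  "real \<Rightarrow> 's measure \<Rightarrow> 'w measure \<Rightarrow>
   ('s set \<Rightarrow> 'w \<Rightarrow> 'b::{real_normed_field,euclidean_space}) \<Rightarrow>
   ('s \<Rightarrow> 'b) \<Rightarrow> ('w \<Rightarrow> 'b) \<Rightarrow> bool" where
  "is_stoch_integral \<alpha> S Q M h Y \<longleftrightarrow>
     Y \<in> borel_measurable Q \<and>
     (\<exists>H. (\<forall>n::nat. simple_function S (H n) \<and> emeasure S {s\<in>space S. H n s \<noteq> 0} < \<infinity>) \<and>
          (\<lambda>n. \<integral>\<^sup>+s. ennreal (norm (H n s - h s) powr \<alpha>) \<partial>S) \<longlonglongrightarrow> 0 \<and>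
          (\<forall>e>0. (\<lambda>n. measure Q {\<omega>\<in>space Q.
             norm (simple_stoch_integral S M (H n) \<omega> - Y \<omega>) > e}) \<longlonglongrightarrow> 0))"

definition process_law ::
  "real set \<Rightarrow> 'w measure \<Rightarrow> (real \<Rightarrow> 'w \<Rightarrow> 'b::euclidean_space) \<Rightarrow> (real \<Rightarrow> 'b) measure" where
  "process_law T P X = distr P (\<Pi>\<^sub>M t\<in>T. borel) (\<lambda>\<omega>. \<lambda>t\<in>T. X t \<omega>)"

definition stationary_process ::
  "real set \<Rightarrow> 'w measure \<Rightarrow> (real \<Rightarrow> 'w \<Rightarrow> 'b::euclidean_space) \<Rightarrow> bool" where
  "stationary_process T P X \<longleftrightarrow>
     prob_space P \<and> (\<forall>t\<in>T. X t \<in> borel_measurable P) \<and>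
     (\<forall>h\<in>T. process_law T P (\<lambda>t. X (t + h)) = process_law T P X)"

definition representation_kernel ::
  "real \<Rightarrow> real set \<Rightarrow> 's measure \<Rightarrow>
   (real \<Rightarrow> 's \<Rightarrow> 'b::{real_normed_field,euclidean_space}) \<Rightarrow> bool" where
  "representation_kernel \<alpha> T S f \<longleftrightarrow>
     standard_lebesgue S \<and>
     (\<lambda>(t, s). f t s) \<in> borel_measurable (restrict_space borel T \<Otimes>\<^sub>M S) \<and>
     (\<forall>t\<in>T. in_L \<alpha> S (f t))"

text \<open>
  The process \<open>X\<close> (on \<open>P\<close>) has the same finite-dimensional distributions as \<open>\<integral>f\<^sub>t dM\<close>, where
  the random measure \<open>M\<close> (on \<open>Q\<close>) has control measure \<open>S\<close>.
\<close>
definition sas_representation ::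
  "real \<Rightarrow> real set \<Rightarrow> 's measure \<Rightarrow>
   (real \<Rightarrow> 's \<Rightarrow> 'b::{real_normed_field,euclidean_space}) \<Rightarrow>
   'q measure \<Rightarrow> ('s set \<Rightarrow> 'q \<Rightarrow> 'b) \<Rightarrow> 'p measure \<Rightarrow> (real \<Rightarrow> 'p \<Rightarrow> 'b) \<Rightarrow> bool" where
  "sas_representation \<alpha> T S f Q M P X \<longleftrightarrow>
     representation_kernel \<alpha> T S f \<and>
     sas_random_measure \<alpha> S Q M \<and>
     prob_space P \<and> (\<forall>t\<in>T. X t \<in> borel_measurable P) \<and>
     (\<exists>Y. (\<forall>t\<in>T. is_stoch_integral \<alpha> S Q M (f t) (Y t)) \<and>
          process_law T P X = process_law T Q Y)"

section \<open>Minimality\<close>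

definition is_support ::
  "real set \<Rightarrow> 's measure \<Rightarrow> (real \<Rightarrow> 's \<Rightarrow> 'b::zero) \<Rightarrow> 's set \<Rightarrow> bool" where
  "is_support T S f A \<longleftrightarrow>
     A \<in> sets S \<and>
     (\<forall>t\<in>T. AE s in S. s \<notin> A \<longrightarrow> f t s = 0) \<and>
     (\<forall>B\<in>sets S. (\<forall>t\<in>T. AE s in S. s \<notin> B \<longrightarrow> f t s = 0) \<longrightarrow>
        (AE s in S. s \<in> A \<longrightarrow> s \<in> B))"

definition full_support ::
  "real set \<Rightarrow> 's measure \<Rightarrow> (real \<Rightarrow> 's \<Rightarrow> 'b::zero) \<Rightarrow> bool" where
  "full_support T S f \<longleftrightarrow> (\<exists>A. is_support T S f A \<and> (AE s in S. s \<in> A))"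

text \<open>
  Ratios take values in the scalars extended by a single point at infinity, \<open>None\<close>; with two
  signed infinities in the real case, ratios would not be invariant under \<open>f\<^sub>t \<mapsto> h f\<^sub>t\<close>. The value
  \<open>0 / 0 = 0\<close> is a convention: another choice gives the same \<open>\<sigma>\<close>-algebra modulo null sets when
  the kernel has full support. The sets in \<open>extended_borel\<close> are the Borel sets of the
  one-point compactification.
\<close>
definition extended_ratio :: "'b::field \<Rightarrow> 'b \<Rightarrow> 'b option" where
  "extended_ratio x y = (if y = 0 \<and> x \<noteq> 0 then None else Some (x / y))"

definition extended_borel :: "'b::topological_space option set set" where
  "extended_borel = {B. Some -` B \<in> sets borel}"

definition ratio_sigma_algebra ::
  "real set \<Rightarrow> 's measure \<Rightarrow> (real \<Rightarrow> 's \<Rightarrow> 'b::real_normed_field) \<Rightarrow> 's set set" where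
  "ratio_sigma_algebra T S f = sigma_sets (space S)
     {(\<lambda>s. extended_ratio (f u s) (f v s)) -` B \<inter> space S | u v B.
        u \<in> T \<and> v \<in> T \<and> B \<in> extended_borel}"

definition minimal_kernel ::
  "real set \<Rightarrow> 's measure \<Rightarrow> (real \<Rightarrow> 's \<Rightarrow> 'b::real_normed_field) \<Rightarrow> bool" where
  "minimal_kernel T S f \<longleftrightarrow>
     full_support T S f \<and>
     (\<forall>B\<in>sets S. \<exists>A\<in>ratio_sigma_algebra T S f. (A - B) \<union> (B - A) \<in> null_sets S)"

section \<open>Flows\<close>

definition flow :: "real set \<Rightarrow> 's measure \<Rightarrow> (real \<Rightarrow> 's \<Rightarrow> 's) \<Rightarrow> bool" where
  "flow T S \<phi> \<longleftrightarrow>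
     (\<forall>t\<in>T. \<forall>s\<in>space S. \<phi> t s \<in> space S) \<and>
     (\<forall>s\<in>space S. \<phi> 0 s = s) \<and>
     (\<forall>t1\<in>T. \<forall>t2\<in>T. \<forall>s\<in>space S. \<phi> (t1 + t2) s = \<phi> t1 (\<phi> t2 s))"

definition measurable_flow :: "real set \<Rightarrow> 's measure \<Rightarrow> (real \<Rightarrow> 's \<Rightarrow> 's) \<Rightarrow> bool" where
  "measurable_flow T S \<phi> \<longleftrightarrow>
     flow T S \<phi> \<and> (\<lambda>(t, s). \<phi> t s) \<in> restrict_space borel T \<Otimes>\<^sub>M S \<rightarrow>\<^sub>M S"

definition nonsingular_flow :: "real set \<Rightarrow> 's measure \<Rightarrow> (real \<Rightarrow> 's \<Rightarrow> 's) \<Rightarrow> bool" where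
  "nonsingular_flow T S \<phi> \<longleftrightarrow>
     (\<forall>t\<in>T. \<forall>N\<in>sets S. emeasure S N = 0 \<longleftrightarrow> emeasure S (\<phi> t -` N \<inter> space S) = 0)"

definition unit_cocycle ::
  "real set \<Rightarrow> 's measure \<Rightarrow> (real \<Rightarrow> 's \<Rightarrow> 's) \<Rightarrow>
   (real \<Rightarrow> 's \<Rightarrow> 'b::{real_normed_field,euclidean_space}) \<Rightarrow> bool" where
  "unit_cocycle T S \<phi> a \<longleftrightarrow>
     (\<lambda>(t, s). a t s) \<in> borel_measurable (restrict_space borel T \<Otimes>\<^sub>M S) \<and>
     (\<forall>t\<in>T. \<forall>s\<in>space S. norm (a t s) = 1) \<and>
     (\<forall>t1\<in>T. \<forall>t2\<in>T. \<forall>s\<in>space S. a (t1 + t2) s = a t1 s * a t2 (\<phi> t1 s))"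

definition periodic_points :: "real set \<Rightarrow> 's measure \<Rightarrow> (real \<Rightarrow> 's \<Rightarrow> 's) \<Rightarrow> 's set" where
  "periodic_points T S \<phi> = {s\<in>space S. \<exists>p\<in>T - {0}. \<phi> p s = s}"

definition fixed_points :: "real set \<Rightarrow> 's measure \<Rightarrow> (real \<Rightarrow> 's \<Rightarrow> 's) \<Rightarrow> 's set" where
  "fixed_points T S \<phi> = {s\<in>space S. \<forall>t\<in>T. \<phi> t s = s}"

definition periodic_flow :: "real set \<Rightarrow> 's measure \<Rightarrow> (real \<Rightarrow> 's \<Rightarrow> 's) \<Rightarrow> bool" where
  "periodic_flow T S \<phi> \<longleftrightarrow> measurable_flow T S \<phi> \<and> (AE s in S. s \<in> periodic_points T S \<phi>)"

definition identity_flow :: "real set \<Rightarrow> 's measure \<Rightarrow> (real \<Rightarrow> 's \<Rightarrow> 's) \<Rightarrow> bool" where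
  "identity_flow T S \<phi> \<longleftrightarrow> measurable_flow T S \<phi> \<and> (AE s in S. s \<in> fixed_points T S \<phi>)"

definition cyclic_flow :: "real set \<Rightarrow> 's measure \<Rightarrow> (real \<Rightarrow> 's \<Rightarrow> 's) \<Rightarrow> bool" where
  "cyclic_flow T S \<phi> \<longleftrightarrow>
     measurable_flow T S \<phi> \<and> (AE s in S. s \<in> periodic_points T S \<phi> - fixed_points T S \<phi>)"

section \<open>Processes generated by a flow\<close>

text \<open>
  The measure \<open>\<nu> \<circ> \<phi>\<^sub>t\<close>, \<open>A \<mapsto> \<nu> (\<phi>\<^sub>t A)\<close>, is the image of \<open>\<nu>\<close> under the inverse \<open>\<phi>\<^sub>-\<^sub>t\<close> of \<open>\<phi>\<^sub>t\<close>.
\<close>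
definition flow_derivative ::
  "'s measure \<Rightarrow> (real \<Rightarrow> 's \<Rightarrow> 's) \<Rightarrow> real \<Rightarrow> 's \<Rightarrow> real" where
  "flow_derivative S \<phi> t s = enn2real (RN_deriv S (distr S S (\<phi> (- t))) s)"

definition kernel_generated_by ::
  "real \<Rightarrow> real set \<Rightarrow> 's measure \<Rightarrow>
   (real \<Rightarrow> 's \<Rightarrow> 'b::{real_normed_field,euclidean_space}) \<Rightarrow> (real \<Rightarrow> 's \<Rightarrow> 's) \<Rightarrow> bool" where
  "kernel_generated_by \<alpha> T S f \<phi> \<longleftrightarrow>
     measurable_flow T S \<phi> \<and> nonsingular_flow T S \<phi> \<and>
     in_L \<alpha> S (f 0) \<and>
     (\<exists>a. unit_cocycle T S \<phi> a \<and>
          (\<forall>t\<in>T. AE s in S.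
             f t s = a t s * of_real (flow_derivative S \<phi> t s powr (1 / \<alpha>)) * f 0 (\<phi> t s))) \<and>
     full_support T S f"

definition process_generated_by ::
  "real \<Rightarrow> real set \<Rightarrow> 's measure \<Rightarrow>
   (real \<Rightarrow> 's \<Rightarrow> 'b::{real_normed_field,euclidean_space}) \<Rightarrow>
   'q measure \<Rightarrow> ('s set \<Rightarrow> 'q \<Rightarrow> 'b) \<Rightarrow> 'p measure \<Rightarrow> (real \<Rightarrow> 'p \<Rightarrow> 'b) \<Rightarrow>
   (real \<Rightarrow> 's \<Rightarrow> 's) \<Rightarrow> bool" where
  "process_generated_by \<alpha> T S f Q M P X \<phi> \<longleftrightarrow>
     stationary_process T P X \<and> sas_representation \<alpha> T S f Q M P X \<and>
     kernel_generated_by \<alpha> T S f \<phi>"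

text \<open>
  The flow is an equivalence class under almost sure equality at each fixed time; the property
  \<open>K\<close> is required of every representative.
\<close>
definition generated_by_unique_flow ::
  "(real set \<Rightarrow> 's measure \<Rightarrow> (real \<Rightarrow> 's \<Rightarrow> 's) \<Rightarrow> bool) \<Rightarrow>
   real \<Rightarrow> real set \<Rightarrow> 's measure \<Rightarrow>
   (real \<Rightarrow> 's \<Rightarrow> 'b::{real_normed_field,euclidean_space}) \<Rightarrow>
   'q measure \<Rightarrow> ('s set \<Rightarrow> 'q \<Rightarrow> 'b) \<Rightarrow> 'p measure \<Rightarrow> (real \<Rightarrow> 'p \<Rightarrow> 'b) \<Rightarrow> bool" where
  "generated_by_unique_flow K \<alpha> T S f Q M P X \<longleftrightarrow>
     (\<exists>\<phi>. process_generated_by \<alpha> T S f Q M P X \<phi>) \<and>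
     (\<forall>\<phi> \<psi>. process_generated_by \<alpha> T S f Q M P X \<phi> \<and> process_generated_by \<alpha> T S f Q M P X \<psi> \<longrightarrow>
        (\<forall>t\<in>T. AE s in S. \<phi> t s = \<psi> t s)) \<and>
     (\<forall>\<phi>. process_generated_by \<alpha> T S f Q M P X \<phi> \<longrightarrow> K T S \<phi>)"

section \<open>Representations of type (I)\<close>

definition dual_set :: "real set \<Rightarrow> real set" where
  "dual_set T = (if T = \<int> then {0..<2 * pi} else UNIV)"

definition control_I_complex :: "real set \<Rightarrow> real measure \<Rightarrow> bool" where
  "control_I_complex T \<eta> \<longleftrightarrow>
     finite_measure \<eta> \<and> sets \<eta> = sets (restrict_space borel (dual_set T))"

definition kernel_I_complex :: "real \<Rightarrow> real \<Rightarrow> complex" where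
  "kernel_I_complex t x = cis (t * x)"

definition control_I_real :: "real set \<Rightarrow> nat measure \<Rightarrow> bool" where
  "control_I_real T \<eta> \<longleftrightarrow>
     finite_measure \<eta> \<and> sets \<eta> = Pow (if T = \<int> then {1, 2} else {1})"

text \<open>For \<open>T\<close> the real line the point 2, hence the second branch, does not occur.\<close>
definition kernel_I_real :: "real \<Rightarrow> nat \<Rightarrow> real" where
  "kernel_I_real t k = (if k = 1 then 1 else (-1) powi \<lfloor>t\<rfloor>)"

section \<open>Representations of type (II)\<close>

definition time_measure :: "real set \<Rightarrow> real measure" where
  "time_measure T = (if T = \<int> then count_space \<int> else lborel)"

definition T_plus :: "real set \<Rightarrow> real set" where
  "T_plus T = (if T = \<int> then {t\<in>\<int>. 2 \<le> t} else {0<..})"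

definition int_part :: "real \<Rightarrow> real \<Rightarrow> int" where
  "int_part a x = (GREATEST n. of_int n * a \<le> x)"

definition frac_part :: "real \<Rightarrow> real \<Rightarrow> real" where
  "frac_part a x = x - a * of_int (int_part a x)"

definition space_II :: "real set \<Rightarrow> 'z measure \<Rightarrow> ('z \<Rightarrow> real) \<Rightarrow> ('z \<times> real) measure" where
  "space_II T \<sigma> q =
     restrict_space (\<sigma> \<Otimes>\<^sub>M time_measure T) {(z, v). z \<in> space \<sigma> \<and> 0 \<le> v \<and> v < q z}"

definition kernel_II ::
  "('z \<Rightarrow> real) \<Rightarrow> ('z \<Rightarrow> 'b::real_normed_field) \<Rightarrow> ('z \<Rightarrow> real \<Rightarrow> 'b) \<Rightarrow>
   real \<Rightarrow> 'z \<times> real \<Rightarrow> 'b" where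
  "kernel_II q b g t = (\<lambda>(z, v).
     b z powi int_part (q z) (v + t) * g z (frac_part (q z) (v + t)))"

definition data_II ::
  "real \<Rightarrow> real set \<Rightarrow> 'z measure \<Rightarrow> ('z \<Rightarrow> real) \<Rightarrow>
   ('z \<Rightarrow> 'b::{real_normed_field,euclidean_space}) \<Rightarrow> ('z \<Rightarrow> real \<Rightarrow> 'b) \<Rightarrow> bool" where
  "data_II \<alpha> T \<sigma> q b g \<longleftrightarrow>
     standard_lebesgue \<sigma> \<and>
     q \<in> borel_measurable \<sigma> \<and> (AE z in \<sigma>. q z \<in> T_plus T) \<and>
     b \<in> borel_measurable \<sigma> \<and> (\<forall>z\<in>space \<sigma>. norm (b z) = 1) \<and>
     in_L \<alpha> (space_II T \<sigma> q) (\<lambda>(z, v). g z v)"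

section \<open>Disjoint unions\<close>

definition sum_measure :: "'s measure \<Rightarrow> 't measure \<Rightarrow> ('s + 't) measure" (infixr "\<oplus>\<^sub>M" 75) where
  "S1 \<oplus>\<^sub>M S2 = measure_of (space S1 <+> space S2) {A <+> B | A B. A \<in> sets S1 \<and> B \<in> sets S2}
     (\<lambda>C. emeasure S1 (Inl -` C) + emeasure S2 (Inr -` C))"

text \<open>
  A random measure with control measure \<open>S1 \<oplus>\<^sub>M S2\<close> restricts to independent random measures with
  control measures \<open>S1\<close> and \<open>S2\<close>, so integrating the following kernel gives the sum of two
  independent integrals.
\<close>
definition sum_kernel ::
  "(real \<Rightarrow> 's \<Rightarrow> 'b) \<Rightarrow> (real \<Rightarrow> 't \<Rightarrow> 'b) \<Rightarrow> real \<Rightarrow> 's + 't \<Rightarrow> 'b" where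
  "sum_kernel f1 f2 t = case_sum (f1 t) (f2 t)"

end

theory Submission
  imports Defs
begin

text \<open>
  Each representation is generated by an explicit measure-preserving flow: the identity for (I),
  with the unimodular kernel itself as cocycle, and \<open>(z, v) \<mapsto> (z, {v + t}\<^bsub>q(z)\<^esub>)\<close> for (II), with
  cocycle \<open>b(z)\<^bsup>[v + t]\<^esup>\<close>. If a flow generates a kernel, the chain rule for Radon-Nikodym
  derivatives gives \<open>f\<^bsub>t+u\<^esub> = h\<^sub>u (f\<^sub>t \<circ> \<phi>\<^sub>u)\<close> with \<open>h\<^sub>u \<noteq> 0\<close> not depending on \<open>t\<close>; hence for two
  generating flows all ratios satisfy \<open>(f\<^sub>v/f\<^sub>w) \<circ> \<phi>\<^sub>u = (f\<^sub>v/f\<^sub>w) \<circ> \<psi>\<^sub>u\<close> a.e., and (M2)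
  together with a countable separating family yields \<open>\<phi>\<^sub>u = \<psi>\<^sub>u\<close> a.e. By Fubini, flows that agree
  a.e. at each time have a.e. the same periods, so the type of the explicit flow is shared by all
  generating flows. Finally, (I) is minimal because the ratios \<open>f\<^sub>t/f\<^sub>0\<close> recover the point: as
  the limit of \<open>n sin(x/n)\<close> on the line, and from \<open>cos x\<close> and the sign of \<open>sin x\<close> on \<open>[0, 2\<pi>)\<close>.
\<close>

section \<open>Standard Borel spaces\<close>

text \<open>A countable base of the Polish topology does it: metrizable spaces are Hausdorff, so
  some basic open set around one point misses the other.\<close>

lemma standard_borel_separating:
  assumes "standard_borel S"
  shows "\<exists>C. countable C \<and> C \<subseteq> sets S \<and>
    (\<forall>x\<in>space S. \<forall>y\<in>space S. x \<noteq> y \<longrightarrow> (\<exists>A\<in>C. x \<in> A \<and> y \<notin> A))"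
proof -
  obtain X where X: "completely_metrizable_space X" "second_countable X" "topspace X = space S"
    and sets: "sets S = sigma_sets (space S) {U. openin X U}"
    using assms by (auto simp: standard_borel_def)
  obtain B where B: "countable B" "\<And>V. V \<in> B \<Longrightarrow> openin X V"
    "\<And>U x. openin X U \<Longrightarrow> x \<in> U \<Longrightarrow> \<exists>V\<in>B. x \<in> V \<and> V \<subseteq> U"
    using X(2) by (auto simp: second_countable_def)
  have haus: "Hausdorff_space X"
    using X(1) completely_metrizable_imp_metrizable_space metrizable_imp_Hausdorff_space by blast
  show ?thesis
  proof (intro exI[of _ B] conjI ballI impI B(1))
    show "B \<subseteq> sets S"
      using B(2) by (auto simp: sets intro: sigma_sets.Basic)
    fix x y assume "x \<in> space S" "y \<in> space S" "x \<noteq> y"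
    then obtain U V where "openin X U" "x \<in> U" "y \<in> V" "disjnt U V"
      using haus X(3) unfolding Hausdorff_space_def by metis
    with B(3) show "\<exists>A\<in>B. x \<in> A \<and> y \<notin> A"
      by (meson disjnt_iff subsetD)
  qed
qed

text \<open>Only the countably many separating sets have to be tested, so their exceptional null
  sets can be united.\<close>

lemma AE_eq_if_AE_vimage:
  assumes S: "standard_borel S" and f: "f \<in> M \<rightarrow>\<^sub>M S" and g: "g \<in> M \<rightarrow>\<^sub>M S"
    and eq: "\<And>A. A \<in> sets S \<Longrightarrow> AE x in M. f x \<in> A \<longleftrightarrow> g x \<in> A"
  shows "AE x in M. f x = g x"
proof -
  obtain C where C: "countable C" "C \<subseteq> sets S"
    "\<forall>x\<in>space S. \<forall>y\<in>space S. x \<noteq> y \<longrightarrow> (\<exists>A\<in>C. x \<in> A \<and> y \<notin> A)"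
    using standard_borel_separating[OF S] by (elim exE conjE) (rule that)
  have "AE x in M. \<forall>A\<in>C. f x \<in> A \<longleftrightarrow> g x \<in> A"
    using C(1,2) eq by (subst AE_ball_countable) auto
  with AE_space show ?thesis
  proof eventually_elim
    case (elim x)
    then show ?case
      using C(3) measurable_space[OF f, of x] measurable_space[OF g, of x] by blast
  qed
qed

text \<open>Disagreement is witnessed by one of countably many separating sets. Applied to two flows
  as functions of time and point jointly, this supplies the measurability that Fubini asks
  for.\<close>

lemma sets_Collect_eq_standard_borel:
  assumes S: "standard_borel S" and [measurable]: "f \<in> M \<rightarrow>\<^sub>M S" "g \<in> M \<rightarrow>\<^sub>M S"
  shows "{x \<in> space M. f x = g x} \<in> sets M"
proof -
  obtain C where C: "countable C" "C \<subseteq> sets S"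
    "\<forall>x\<in>space S. \<forall>y\<in>space S. x \<noteq> y \<longrightarrow> (\<exists>A\<in>C. x \<in> A \<and> y \<notin> A)"
    using standard_borel_separating[OF S] by (elim exE conjE) (rule that)
  have "{x \<in> space M. f x = g x} =
      space M - (\<Union>A\<in>C. (f -` A \<inter> space M) - (g -` A \<inter> space M))"
  proof (intro equalityI subsetI)
    fix x assume x: "x \<in> space M - (\<Union>A\<in>C. (f -` A \<inter> space M) - (g -` A \<inter> space M))"
    then have "f x \<in> space S" "g x \<in> space S"
      by (auto intro: measurable_space[OF assms(2)] measurable_space[OF assms(3)])
    with x C(3) show "x \<in> {x \<in> space M. f x = g x}"
      by blast
  qed auto
  also have "\<dots> \<in> sets M"
    using C(1,2) by (intro sets.Diff sets.countable_UN' sets.top) (auto intro!: measurable_sets[of _ M S])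
  finally show ?thesis .
qed

section \<open>Nonsingular flows\<close>

locale index_set =
  fixes T :: "real set"
  assumes T_cases: "T = \<int> \<or> T = UNIV"
begin

lemma zero_in [simp, intro]: "0 \<in> T"
  and add_in [simp, intro]: "s \<in> T \<Longrightarrow> t \<in> T \<Longrightarrow> s + t \<in> T"
  and minus_in [simp, intro]: "t \<in> T \<Longrightarrow> - t \<in> T"
  using T_cases by auto

lemma diff_in [simp, intro]: "s \<in> T \<Longrightarrow> t \<in> T \<Longrightarrow> s - t \<in> T"
  using T_cases by auto

lemma one_in [simp, intro]: "1 \<in> T"
  using T_cases by auto

end

locale time_flow = index_set T for T +
  fixes S :: "'s measure" and \<phi> :: "real \<Rightarrow> 's \<Rightarrow> 's"
  assumes measurable_flow: "measurable_flow T S \<phi>"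
begin

lemma in_space: "t \<in> T \<Longrightarrow> s \<in> space S \<Longrightarrow> \<phi> t s \<in> space S"
  and zero [simp]: "s \<in> space S \<Longrightarrow> \<phi> 0 s = s"
  and add: "t \<in> T \<Longrightarrow> u \<in> T \<Longrightarrow> s \<in> space S \<Longrightarrow> \<phi> (t + u) s = \<phi> t (\<phi> u s)"
  using measurable_flow by (auto simp: measurable_flow_def flow_def)

lemma uminus_cancel [simp]:
  assumes "t \<in> T" "s \<in> space S"
  shows "\<phi> t (\<phi> (- t) s) = s" "\<phi> (- t) (\<phi> t s) = s"
  using add[of t "- t" s] add[of "- t" t s] assms by auto

lemma measurable_at: "t \<in> T \<Longrightarrow> \<phi> t \<in> S \<rightarrow>\<^sub>M S"
  using measurable_flow measurable_Pair2[of "\<lambda>(t, s). \<phi> t s" "restrict_space borel T" S S t]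
  unfolding measurable_flow_def by (auto simp: space_restrict_space)

end

locale nonsingular_time_flow = time_flow T S \<phi> + sigma_finite_measure S
  for T and S :: "'s measure" and \<phi> +
  assumes nonsingular: "nonsingular_flow T S \<phi>"
begin

lemma AE_flow:
  assumes t: "t \<in> T" and P: "AE s in S. P s"
  shows "AE s in S. P (\<phi> t s)"
proof -
  obtain N where N: "N \<in> null_sets S" "{s \<in> space S. \<not> P s} \<subseteq> N"
    using P by (auto simp: eventually_ae_filter)
  have "\<phi> t -` N \<inter> space S \<in> null_sets S"
    using nonsingular t N(1) measurable_sets[OF measurable_at[OF t], of N]
    by (auto simp: nonsingular_flow_def null_sets_def)
  moreover have "{s \<in> space S. \<not> P (\<phi> t s)} \<subseteq> \<phi> t -` N \<inter> space S"
    using N(2) in_space[OF t] by auto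
  ultimately show ?thesis
    unfolding eventually_ae_filter by blast
qed

section \<open>Radon-Nikodym derivatives along a nonsingular flow\<close>

abbreviation "D t \<equiv> RN_deriv S (distr S S (\<phi> (- t)))"

lemma absolutely_continuous_distr:
  assumes t: "t \<in> T"
  shows "absolutely_continuous S (distr S S (\<phi> t))"
proof -
  have "N \<in> null_sets (distr S S (\<phi> t))" if "N \<in> null_sets S" for N
    using nonsingular[unfolded nonsingular_flow_def, rule_format, OF t, of N] that
    by (simp add: null_sets_def emeasure_distr[OF measurable_at[OF t]])
  then show ?thesis
    by (auto simp: absolutely_continuous_def)
qed

lemma density_D:
  assumes "t \<in> T"
  shows "density S (D t) = distr S S (\<phi> (- t))"
  using absolutely_continuous_distr[of "- t"] assms by (intro density_RN_deriv) auto

text \<open>Finiteness of the derivative comes from \<sigma>-finiteness of the image under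
  \<open>\<phi> (- t)\<close>: pushing that image forward by \<open>\<phi> t\<close> returns
  \<open>S\<close>, and \<sigma>-finiteness of an image measure passes back to its source.\<close>

lemma D_neq_top:
  assumes t: "t \<in> T"
  shows "AE s in S. D t s \<noteq> \<infinity>"
proof (rule RN_deriv_finite)
  have [measurable]: "\<phi> t \<in> S \<rightarrow>\<^sub>M S" "\<phi> (- t) \<in> S \<rightarrow>\<^sub>M S"
    using t by (auto intro: measurable_at)
  have "distr (distr S S (\<phi> (- t))) S (\<phi> t) = distr S S (\<lambda>s. s)"
    using t by (subst distr_distr) (auto intro!: distr_cong simp del: distr_id simp: o_def)
  then have "sigma_finite_measure (distr (distr S S (\<phi> (- t))) S (\<phi> t))"
    using sigma_finite_measure_axioms by (simp add: distr_id)
  then show "sigma_finite_measure (distr S S (\<phi> (- t)))"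
    by (rule sigma_finite_measure_distr) simp
qed (use t absolutely_continuous_distr in auto)

text \<open>The zero set of the derivative has a null preimage under \<open>\<phi> (- t)\<close>.
  Nonsingularity, read from the preimage to the set, makes it null.\<close>

lemma D_neq_0:
  assumes t: "t \<in> T"
  shows "AE s in S. D t s \<noteq> 0"
proof -
  let ?N = "{s \<in> space S. D t s = 0}"
  have N: "?N \<in> sets S" by simp
  have "emeasure S (\<phi> (- t) -` ?N \<inter> space S) = emeasure (distr S S (\<phi> (- t))) ?N"
    using t measurable_at by (subst emeasure_distr) auto
  also have "\<dots> = emeasure (density S (D t)) ?N"
    by (simp add: density_D t)
  also have "\<dots> = (\<integral>\<^sup>+s. 0 \<partial>S)"
    unfolding emeasure_density[OF borel_measurable_RN_deriv N]
    by (intro nn_integral_cong) (auto simp: indicator_def)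
  finally have "emeasure S ?N = 0"
    using nonsingular minus_in[OF t] N by (auto simp: nonsingular_flow_def)
  then show ?thesis
    by (intro AE_I[of _ _ ?N]) auto
qed

text \<open>Chain rule. By uniqueness of Radon-Nikodym derivatives it is enough that the product is
  a density of the image under \<open>\<phi> (- (t + u))\<close>; two changes of variables show
  this.\<close>

lemma D_add:
  assumes t: "t \<in> T" and u: "u \<in> T"
  shows "AE s in S. D (t + u) s = D u s * D t (\<phi> u s)"
proof -
  note [measurable] = measurable_at[OF u] measurable_at[OF t]
    measurable_at[OF minus_in[OF u]] measurable_at[OF minus_in[OF t]]
    measurable_at[OF minus_in[OF add_in[OF t u]]]
  have "density S (\<lambda>s. D u s * D t (\<phi> u s)) = distr S S (\<phi> (- (t + u)))"
  proof (rule measure_eqI)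
    fix A assume "A \<in> sets (density S (\<lambda>s. D u s * D t (\<phi> u s)))"
    then have [measurable]: "A \<in> sets S" by simp
    have A: "A \<subseteq> space S"
      by (rule sets.sets_into_space) simp
    have "emeasure (density S (\<lambda>s. D u s * D t (\<phi> u s))) A =
        (\<integral>\<^sup>+s. D u s * (D t (\<phi> u s) * indicator A s) \<partial>S)"
      by (subst emeasure_density) (auto simp: mult.assoc)
    also have "\<dots> = (\<integral>\<^sup>+s. D t (\<phi> u s) * indicator A s \<partial>density S (D u))"
      by (subst nn_integral_density) auto
    \<comment> \<open>The measure with density \<open>D u\<close> is the image of \<open>S\<close>
      under \<open>\<phi> (- u)\<close>, so integrating against it substitutes
      \<open>\<phi> (- u) s\<close>, and the argument of \<open>D t\<close> collapses to
      \<open>s\<close>.\<close>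
    also have "\<dots> = (\<integral>\<^sup>+s. D t (\<phi> u (\<phi> (- u) s)) * indicator A (\<phi> (- u) s) \<partial>S)"
      unfolding density_D[OF u] by (subst nn_integral_distr) auto
    also have "\<dots> = (\<integral>\<^sup>+s. D t s * indicator (\<phi> (- u) -` A \<inter> space S) s \<partial>S)"
      using u by (intro nn_integral_cong) (auto simp: indicator_def)
    also have "\<dots> = emeasure (density S (D t)) (\<phi> (- u) -` A \<inter> space S)"
      by (subst emeasure_density) auto
    also have "\<dots> = emeasure S (\<phi> (- t) -` (\<phi> (- u) -` A \<inter> space S) \<inter> space S)"
      unfolding density_D[OF t] by (subst emeasure_distr) auto
    also have "\<phi> (- t) -` (\<phi> (- u) -` A \<inter> space S) \<inter> space S = \<phi> (- (t + u)) -` A \<inter> space S"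
      using add[of "- u" "- t"] in_space[of "- t"] t u by (auto simp: add.commute)
    also have "emeasure S \<dots> = emeasure (distr S S (\<phi> (- (t + u)))) A"
      by (subst emeasure_distr) (use t u in \<open>auto intro!: measurable_at simp del: minus_add_distrib\<close>)
    finally show "emeasure (density S (\<lambda>s. D u s * D t (\<phi> u s))) A =
      emeasure (distr S S (\<phi> (- (t + u)))) A" .
  qed simp
  from RN_deriv_unique[OF _ this] show ?thesis
    by (auto elim!: eventually_mono)
qed

lemma flow_derivative_pos:
  assumes "t \<in> T"
  shows "AE s in S. 0 < flow_derivative S \<phi> t s"
  using D_neq_0[OF assms] D_neq_top[OF assms]
  by eventually_elim (simp add: flow_derivative_def enn2real_positive_iff less_top zero_less_iff_neq_zero)

lemma flow_derivative_add:
  assumes "t \<in> T" "u \<in> T"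
  shows "AE s in S. flow_derivative S \<phi> (t + u) s =
    flow_derivative S \<phi> u s * flow_derivative S \<phi> t (\<phi> u s)"
  using D_add[OF assms] by eventually_elim (simp add: flow_derivative_def enn2real_mult)

end

section \<open>Uniqueness of the generating flow\<close>

lemma extended_ratio_mult:
  "c \<noteq> 0 \<Longrightarrow> extended_ratio (c * x) (c * y) = extended_ratio x y"
  by (simp add: extended_ratio_def)

text \<open>The target family \<open>f'\<close> is kept separate because it will be the kernel
  shifted by a fixed time, the same for two competing flows. The multiplier may vary with the map,
  but not with \<open>t\<close>.\<close>

definition multiplier_map ::
  "real set \<Rightarrow> 's measure \<Rightarrow> (real \<Rightarrow> 's \<Rightarrow> 'b::field) \<Rightarrow> (real \<Rightarrow> 's \<Rightarrow> 'b) \<Rightarrow> ('s \<Rightarrow> 's) \<Rightarrow> bool" where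
  "multiplier_map T S f f' \<theta> \<longleftrightarrow>
    (\<exists>h. (AE s in S. h s \<noteq> 0) \<and> (\<forall>t\<in>T. AE s in S. f' t s = h s * f t (\<theta> s)))"

text \<open>Maps transforming the kernel by a common multiplier agree on the sets generated by ratios,
  hence, by (M2), on all sets.\<close>
lemma minimal_kernel_unique_map:
  assumes S: "standard_borel S" and min: "minimal_kernel T S f"
    and meas: "\<theta>1 \<in> S \<rightarrow>\<^sub>M S" "\<theta>2 \<in> S \<rightarrow>\<^sub>M S"
    and null: "\<And>N. N \<in> null_sets S \<Longrightarrow> AE s in S. \<theta>1 s \<notin> N"
      "\<And>N. N \<in> null_sets S \<Longrightarrow> AE s in S. \<theta>2 s \<notin> N"
    and mult: "multiplier_map T S f f' \<theta>1" "multiplier_map T S f f' \<theta>2"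
  shows "AE s in S. \<theta>1 s = \<theta>2 s"
proof (rule AE_eq_if_AE_vimage[OF S meas])
  fix B assume B: "B \<in> sets S"
  obtain h1 where h1: "AE s in S. h1 s \<noteq> 0" "\<And>t. t \<in> T \<Longrightarrow> AE s in S. f' t s = h1 s * f t (\<theta>1 s)"
    using mult(1) by (auto simp: multiplier_map_def)
  obtain h2 where h2: "AE s in S. h2 s \<noteq> 0" "\<And>t. t \<in> T \<Longrightarrow> AE s in S. f' t s = h2 s * f t (\<theta>2 s)"
    using mult(2) by (auto simp: multiplier_map_def)
  \<comment> \<open>The two multipliers may differ, yet each cancels: both ratios equal the ratio of
    \<open>f' u\<close> to \<open>f' v\<close>.\<close>
  have ratio: "AE s in S. extended_ratio (f u (\<theta>1 s)) (f v (\<theta>1 s)) =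
      extended_ratio (f u (\<theta>2 s)) (f v (\<theta>2 s))" if "u \<in> T" "v \<in> T" for u v
    using h1(1) h1(2)[OF that(1)] h1(2)[OF that(2)] h2(1) h2(2)[OF that(1)] h2(2)[OF that(2)]
  proof eventually_elim
    case (elim s)
    then show ?case
      using extended_ratio_mult[of "h1 s" "f u (\<theta>1 s)" "f v (\<theta>1 s)"]
        extended_ratio_mult[of "h2 s" "f u (\<theta>2 s)" "f v (\<theta>2 s)"] by simp
  qed
  have space: "\<theta>1 s \<in> space S" "\<theta>2 s \<in> space S" if "s \<in> space S" for s
    using meas that by (auto dest: measurable_space)
  \<comment> \<open>The sets whose preimages under the two maps agree up to a null set are closed
    under complements and countable unions, so the generators decide.\<close>
  have generated: "AE s in S. \<theta>1 s \<in> A \<longleftrightarrow> \<theta>2 s \<in> A" if "A \<in> ratio_sigma_algebra T S f" for A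
    using that unfolding ratio_sigma_algebra_def
  proof (induction rule: sigma_sets.induct)
    case (Basic A)
    then obtain u v E where uv: "u \<in> T" "v \<in> T"
      and A: "A = (\<lambda>s. extended_ratio (f u s) (f v s)) -` E \<inter> space S"
      by auto
    show ?case
      using ratio[OF uv] AE_space by eventually_elim (auto simp: A space)
  next
    case (Compl A)
    show ?case
      using Compl.IH AE_space by eventually_elim (auto simp: space)
  next
    case (Union A)
    have "AE s in S. \<forall>i. \<theta>1 s \<in> A i \<longleftrightarrow> \<theta>2 s \<in> A i"
      using Union.IH by (simp add: AE_all_countable)
    then show ?case
      by eventually_elim auto
  qed simp
  \<comment> \<open>(M2) replaces \<open>B\<close> by a ratio-measurable set up to a null set, and
    almost no point is sent into that null set by either map.\<close>
  obtain A where A: "A \<in> ratio_sigma_algebra T S f" "(A - B) \<union> (B - A) \<in> null_sets S"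
    using min B by (auto simp: minimal_kernel_def)
  show "AE s in S. \<theta>1 s \<in> B \<longleftrightarrow> \<theta>2 s \<in> B"
    using generated[OF A(1)] null(1)[OF A(2)] null(2)[OF A(2)] by eventually_elim blast
qed

text \<open>The cocycle identity and the chain rule split the factors of \<open>f (t + u)\<close>
  into one depending on \<open>u\<close> alone and the factors of \<open>f t\<close> evaluated at
  \<open>\<phi> u s\<close>. The part depending on \<open>u\<close> is the multiplier.\<close>

lemma kernel_generated_by_multiplier_map:
  fixes f :: "real \<Rightarrow> 's \<Rightarrow> 'b::{real_normed_field,euclidean_space}"
  assumes T: "index_set T" and S: "sigma_finite_measure S"
    and gen: "kernel_generated_by \<alpha> T S f \<phi>" and u: "u \<in> T"
  shows "multiplier_map T S f (\<lambda>t. f (t + u)) (\<phi> u)"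
proof -
  interpret index_set T by (rule T)
  interpret sigma_finite_measure S by (rule S)
  interpret nonsingular_time_flow T S \<phi>
    by unfold_locales (use gen in \<open>auto simp: kernel_generated_by_def\<close>)
  obtain a where a: "unit_cocycle T S \<phi> a"
    and f: "\<And>t. t \<in> T \<Longrightarrow> AE s in S.
      f t s = a t s * of_real (flow_derivative S \<phi> t s powr (1 / \<alpha>)) * f 0 (\<phi> t s)"
    using gen by (auto simp: kernel_generated_by_def)
  let ?d = "\<lambda>t s. flow_derivative S \<phi> t s"
  let ?h = "\<lambda>s. a u s * of_real (?d u s powr (1 / \<alpha>))"
  have "AE s in S. ?h s \<noteq> 0"
    using flow_derivative_pos[OF u] AE_space
  proof eventually_elim
    case (elim s)
    then have "norm (a u s) = 1"
      using a u by (simp add: unit_cocycle_def)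
    with elim show ?case by auto
  qed
  \<comment> \<open>The relation for \<open>f t\<close> is needed at the point
    \<open>\<phi> u s\<close>; nonsingularity carries its exceptional null set over.\<close>
  moreover have "AE s in S. f (t + u) s = ?h s * f t (\<phi> u s)" if t: "t \<in> T" for t
    using f[OF add_in[OF t u]] AE_flow[OF u f[OF t]] flow_derivative_add[OF t u]
      flow_derivative_pos[OF u] AE_space
  proof eventually_elim
    case (elim s)
    \<comment> \<open>The cocycle runs through its first time first, so the sum is read as
      \<open>u + t\<close> to have the second factor evaluated at \<open>\<phi> u s\<close>.\<close>
    have "a (t + u) s = a u s * a t (\<phi> u s)"
      using a t u elim(5) unfolding unit_cocycle_def by (metis add.commute)
    moreover have "?d (t + u) s powr (1 / \<alpha>) = ?d u s powr (1 / \<alpha>) * ?d t (\<phi> u s) powr (1 / \<alpha>)"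
      unfolding elim(3) by (rule powr_mult)
    ultimately show ?case
      using elim(1,2) add[OF t u elim(5)] by (simp add: algebra_simps)
  qed
  ultimately show ?thesis
    unfolding multiplier_map_def by (intro exI[of _ ?h] conjI ballI)
qed

text \<open>Both \<open>\<phi> u\<close> and \<open>\<psi> u\<close> carry the kernel, up to a
  multiplier, to the same shifted kernel, and (M2) allows only one such map.\<close>

lemma generating_flow_unique:
  fixes f :: "real \<Rightarrow> 's \<Rightarrow> 'b::{real_normed_field,euclidean_space}"
  assumes T: "index_set T" and S: "standard_lebesgue S" and min: "minimal_kernel T S f"
    and gen: "kernel_generated_by \<alpha> T S f \<phi>" "kernel_generated_by \<alpha> T S f \<psi>" and u: "u \<in> T"
  shows "AE s in S. \<phi> u s = \<psi> u s"
proof -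
  have sigma: "sigma_finite_measure S"
    using S by (simp add: standard_lebesgue_def)
  interpret index_set T by (rule T)
  interpret sigma_finite_measure S by (rule sigma)
  interpret A: nonsingular_time_flow T S \<phi>
    by unfold_locales (use gen in \<open>auto simp: kernel_generated_by_def\<close>)
  interpret B: nonsingular_time_flow T S \<psi>
    by unfold_locales (use gen in \<open>auto simp: kernel_generated_by_def\<close>)
  show ?thesis
  proof (rule minimal_kernel_unique_map[OF _ min])
    show "standard_borel S" using S by (simp add: standard_lebesgue_def)
    show "multiplier_map T S f (\<lambda>t. f (t + u)) (\<phi> u)" "multiplier_map T S f (\<lambda>t. f (t + u)) (\<psi> u)"
      using kernel_generated_by_multiplier_map[OF T sigma] gen u by auto
  qed (use u A.measurable_at B.measurable_at in
      \<open>auto intro: A.AE_flow[OF u AE_not_in] B.AE_flow[OF u AE_not_in]\<close>)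
qed

section \<open>Flows that agree almost everywhere at each time\<close>

context index_set
begin

text \<open>Every set of integers is countable, hence Borel. The joint measurability required of
  flows is thereby available over the \<sigma>-finite time measure, as Fubini needs.\<close>

lemma sets_time_measure: "sets (time_measure T) = sets (restrict_space borel T)"
proof (cases "T = \<int>")
  case True
  have "A \<in> sets borel" if "A \<subseteq> \<int>" for A :: "real set"
    using countable_subset[OF that countable_int] by (rule sets.countable[rotated]) simp
  then have "A \<in> (\<inter>) \<int> ` sets borel" if "A \<in> Pow \<int>" for A :: "real set"
    using that by (intro image_eqI[of _ _ A]) auto
  then have "Pow \<int> = (\<inter>) \<int> ` sets (borel :: real measure)"
    by (intro equalityI subsetI) auto
  then show ?thesis
    using True by (simp add: time_measure_def sets_restrict_space)
next
  case False
  then show ?thesis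
    using T_cases by (simp add: time_measure_def sets_restrict_space)
qed

lemma space_time_measure: "space (time_measure T) = T"
  using T_cases by (auto simp: time_measure_def)

lemma sigma_finite_time_measure: "sigma_finite_measure (time_measure T)"
  using T_cases sigma_finite_lborel sigma_finite_measure_count_space_countable[OF countable_int]
  by (auto simp: time_measure_def)

lemma measurable_plus_time: "c \<in> T \<Longrightarrow> (+) c \<in> time_measure T \<rightarrow>\<^sub>M time_measure T"
  using T_cases by (auto simp: time_measure_def)

lemma distr_plus_time:
  assumes c: "c \<in> T"
  shows "distr (time_measure T) (time_measure T) ((+) c) = time_measure T"
proof (cases "T = \<int>")
  case True
  have "bij_betw ((+) c) \<int> \<int>"
    using c True by (intro bij_betwI[where g = "\<lambda>x. x - c"]) auto
  then show ?thesis
    using True by (simp add: time_measure_def distr_bij_count_space)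
next
  case False
  have "distr lborel lborel ((+) c) = distr lborel borel ((+) c)"
    by (rule distr_cong) auto
  then show ?thesis
    using False by (simp add: time_measure_def lborel_distr_plus)
qed

lemma AE_time_plus:
  assumes c: "c \<in> T" and P: "AE t in time_measure T. P t"
  shows "AE t in time_measure T. P (c + t)"
  using P AE_distrD[OF measurable_plus_time[OF c]] distr_plus_time[OF c] by metis

lemma not_AE_time_False: "\<not> (AE t in time_measure T. False)"
proof -
  have "emeasure (time_measure T) T \<noteq> 0"
    using T_cases Ints_0 by (auto simp: time_measure_def emeasure_count_space_eq_0)
  then show ?thesis
    using AE_iff_measurable[of T "time_measure T" "\<lambda>_. False"] sets.top[of "time_measure T"]
    by (simp add: space_time_measure)
qed

text \<open>A conull set of times meets its own translate by \<open>p\<close>, since the time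
  measure is translation invariant and nonzero.\<close>

lemma AE_time_obtain:
  assumes "p \<in> T" "AE t in time_measure T. P t"
  obtains t where "t \<in> T" "P t" "P (t + p)"
proof -
  have "AE t in time_measure T. t \<in> T \<and> P t \<and> P (p + t)"
    using AE_space assms(2) AE_time_plus[OF assms] by eventually_elim (simp add: space_time_measure)
  then have "\<exists>t. t \<in> T \<and> P t \<and> P (p + t)"
    by (rule eventually_happens'[rotated]) (use not_AE_time_False in \<open>simp add: trivial_limit_def\<close>)
  then show thesis
    using that by (auto simp: add.commute)
qed

text \<open>By Fubini almost every orbit agrees at almost all times; two times differing by \<open>p\<close> are then
  enough to carry the relation \<open>\<phi>\<^sub>p s = s\<close> over.\<close>
lemma AE_same_stabilizer:
  assumes S: "standard_lebesgue S" and flows: "measurable_flow T S \<phi>" "measurable_flow T S \<psi>"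
    and eq: "\<And>t. t \<in> T \<Longrightarrow> AE s in S. \<phi> t s = \<psi> t s"
  shows "AE s in S. \<forall>p\<in>T. \<phi> p s = s \<longleftrightarrow> \<psi> p s = s"
proof -
  interpret A: time_flow T S \<phi> by unfold_locales (rule flows)
  interpret B: time_flow T S \<psi> by unfold_locales (rule flows)
  interpret pair_sigma_finite "time_measure T" S
    using S sigma_finite_time_measure by (simp add: pair_sigma_finite_def standard_lebesgue_def)
  have "sets (restrict_space borel T \<Otimes>\<^sub>M S) = sets (time_measure T \<Otimes>\<^sub>M S)"
    by (intro sets_pair_measure_cong) (simp_all add: sets_time_measure)
  then have "(\<lambda>(t, s). \<phi> t s) \<in> time_measure T \<Otimes>\<^sub>M S \<rightarrow>\<^sub>M S" "(\<lambda>(t, s). \<psi> t s) \<in> time_measure T \<Otimes>\<^sub>M S \<rightarrow>\<^sub>M S"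
    using flows by (auto simp: measurable_flow_def cong: measurable_cong_sets)
  \<comment> \<open>Joint measurability of the agreement set licenses the exchange of the two
    almost-everywhere quantifiers below.\<close>
  then have "{x \<in> space (time_measure T \<Otimes>\<^sub>M S). \<phi> (fst x) (snd x) = \<psi> (fst x) (snd x)}
      \<in> sets (time_measure T \<Otimes>\<^sub>M S)"
    using sets_Collect_eq_standard_borel[of S "\<lambda>(t, s). \<phi> t s" _ "\<lambda>(t, s). \<psi> t s"] S
    by (simp add: standard_lebesgue_def split_beta')
  moreover have "AE t in time_measure T. AE s in S. \<phi> t s = \<psi> t s"
    by (intro AE_I2 eq) (simp add: space_time_measure)
  ultimately have "AE s in S. AE t in time_measure T. \<phi> t s = \<psi> t s"
    by (simp add: AE_commute)
  with AE_space show ?thesis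
  proof eventually_elim
    case (elim s)
    show ?case
    proof
      \<comment> \<open>The exceptional null set was chosen before \<open>p\<close>, so uncountably
        many \<open>p\<close> do no harm; only the auxiliary time \<open>t\<close> depends on
        \<open>p\<close>.\<close>
      fix p assume p: "p \<in> T"
      obtain t where t: "t \<in> T" "\<phi> t s = \<psi> t s" "\<phi> (t + p) s = \<psi> (t + p) s"
        using AE_time_obtain[OF p elim(2)] .
      have tp: "\<phi> (t + p) s = \<phi> t (\<phi> p s)" "\<psi> (t + p) s = \<psi> t (\<psi> p s)"
        using t p elim(1) A.add B.add by auto
      \<comment> \<open>Flow maps are injective, so \<open>p\<close> fixes \<open>s\<close> exactly
        when the orbit takes the same value at times \<open>t\<close> and \<open>t + p\<close>. At
        these two times the orbits coincide.\<close>
      have inj: "\<phi> t x = \<phi> t s \<longleftrightarrow> x = s" "\<psi> t x = \<psi> t s \<longleftrightarrow> x = s" if "x \<in> space S" for x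
        using A.uminus_cancel(2)[OF t(1)] B.uminus_cancel(2)[OF t(1)] that elim(1)
        by (auto dest: arg_cong[of _ _ "\<phi> (- t)"] arg_cong[of _ _ "\<psi> (- t)"])
      show "\<phi> p s = s \<longleftrightarrow> \<psi> p s = s"
        using inj(1)[OF A.in_space[OF p elim(1)]] inj(2)[OF B.in_space[OF p elim(1)]] t tp
        by simp
    qed
  qed
qed

text \<open>Periodic and fixed points are both determined by the set of times fixing
  \<open>s\<close>, which is almost everywhere the same for the two flows.\<close>

lemma
  assumes "standard_lebesgue S" "measurable_flow T S \<psi>"
    and "\<And>t. t \<in> T \<Longrightarrow> AE s in S. \<phi> t s = \<psi> t s"
  shows periodic_flow_transfer: "periodic_flow T S \<phi> \<Longrightarrow> periodic_flow T S \<psi>"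
    and identity_flow_transfer: "identity_flow T S \<phi> \<Longrightarrow> identity_flow T S \<psi>"
    and cyclic_flow_transfer: "cyclic_flow T S \<phi> \<Longrightarrow> cyclic_flow T S \<psi>"
proof -
  have "(AE s in S. s \<in> periodic_points T S \<phi> \<longleftrightarrow> s \<in> periodic_points T S \<psi>) \<and>
      (AE s in S. s \<in> fixed_points T S \<phi> \<longleftrightarrow> s \<in> fixed_points T S \<psi>)" if "measurable_flow T S \<phi>"
    using AE_same_stabilizer[OF assms(1) that assms(2,3)]
    by (auto simp: periodic_points_def fixed_points_def elim: eventually_mono)
  with assms(2) show "periodic_flow T S \<phi> \<Longrightarrow> periodic_flow T S \<psi>"
    "identity_flow T S \<phi> \<Longrightarrow> identity_flow T S \<psi>" "cyclic_flow T S \<phi> \<Longrightarrow> cyclic_flow T S \<psi>"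
    unfolding periodic_flow_def identity_flow_def cyclic_flow_def by (auto elim: AE_mp)
qed

text \<open>One generating flow of the right type is enough: uniqueness makes every other agree with
  it at each time. \<open>K\<close> ranges over the three types for which such agreement is known to
  transfer the property.\<close>

lemma generated_by_unique_flowI:
  assumes "stationary_process T P X" "sas_representation \<alpha> T S f Q M P X" "minimal_kernel T S f"
    and gen: "kernel_generated_by \<alpha> T S f \<phi>" and K: "K T S \<phi>"
    and "K \<in> {periodic_flow, identity_flow, cyclic_flow}"
  shows "generated_by_unique_flow K \<alpha> T S f Q M P X"
proof -
  have S: "standard_lebesgue S"
    using assms(2) by (simp add: sas_representation_def representation_kernel_def)
  note unique = generating_flow_unique[OF index_set_axioms S assms(3)]
  have "K T S \<psi>" if "kernel_generated_by \<alpha> T S f \<psi>" for \<psi>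
  proof -
    have "measurable_flow T S \<psi>"
      using that by (simp add: kernel_generated_by_def)
    note transfer = periodic_flow_transfer[OF S this unique[OF gen that]]
      identity_flow_transfer[OF S this unique[OF gen that]]
      cyclic_flow_transfer[OF S this unique[OF gen that]]
    show ?thesis
      using assms(6) K transfer by auto
  qed
  then show ?thesis
    using assms unique unfolding generated_by_unique_flow_def process_generated_by_def by blast
qed

end

section \<open>Measure-preserving flows generating a kernel\<close>

text \<open>The case where every Radon-Nikodym factor is 1, so that the exponent 1 / \<alpha>
  disappears and the condition combines componentwise on disjoint unions.\<close>

definition preserving_generator ::
  "real set \<Rightarrow> 's measure \<Rightarrow> (real \<Rightarrow> 's \<Rightarrow> 'b::{real_normed_field,euclidean_space}) \<Rightarrow>
   (real \<Rightarrow> 's \<Rightarrow> 's) \<Rightarrow> (real \<Rightarrow> 's \<Rightarrow> 'b) \<Rightarrow> bool" where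
  "preserving_generator T S f \<phi> a \<longleftrightarrow>
    measurable_flow T S \<phi> \<and> (\<forall>t\<in>T. distr S S (\<phi> t) = S) \<and> unit_cocycle T S \<phi> a \<and>
    (\<forall>t\<in>T. AE s in S. f t s = a t s * f 0 (\<phi> t s))"

text \<open>Preservation gives nonsingularity at once, and the constant 1 is a density of the image
  measure, hence almost everywhere its derivative.\<close>

lemma (in index_set) preserving_generator_imp_generated:
  fixes f :: "real \<Rightarrow> 's \<Rightarrow> 'b::{real_normed_field,euclidean_space}"
  assumes gen: "preserving_generator T S f \<phi> a"
    and S: "sigma_finite_measure S" and f0: "in_L \<alpha> S (f 0)" and supp: "full_support T S f"
  shows "kernel_generated_by \<alpha> T S f \<phi>"
proof -
  interpret sigma_finite_measure S by (rule S)
  interpret time_flow T S \<phi>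
    by unfold_locales (use gen in \<open>simp add: preserving_generator_def\<close>)
  have preserve: "distr S S (\<phi> t) = S" if "t \<in> T" for t
    using gen that by (simp add: preserving_generator_def)
  have "emeasure S (\<phi> t -` N \<inter> space S) = emeasure S N" if "t \<in> T" "N \<in> sets S" for t N
    using emeasure_distr[OF measurable_at[OF that(1)] that(2)] preserve[OF that(1)] by simp
  then have "nonsingular_flow T S \<phi>"
    by (simp add: nonsingular_flow_def)
  moreover have "AE s in S. f t s = a t s * of_real (flow_derivative S \<phi> t s powr (1 / \<alpha>)) * f 0 (\<phi> t s)"
    if t: "t \<in> T" for t
  proof -
    have "AE s in S. 1 = RN_deriv S (distr S S (\<phi> (- t))) s"
      using preserve[OF minus_in[OF t]] by (intro RN_deriv_unique) (simp_all add: density_1)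
    moreover have "AE s in S. f t s = a t s * f 0 (\<phi> t s)"
      using gen t by (simp add: preserving_generator_def)
    ultimately show ?thesis
      by eventually_elim (simp add: flow_derivative_def flip: One_nat_def)
  qed
  ultimately show ?thesis
    using gen f0 supp unfolding kernel_generated_by_def preserving_generator_def by blast
qed

text \<open>Multiplicativity in time is the cocycle identity over a flow that moves nothing, so the
  kernel serves as its own cocycle. The factor \<open>f 0\<close> comes from
  \<open>t = t + 0\<close>.\<close>

lemma (in index_set) preserving_generator_identity:
  fixes f :: "real \<Rightarrow> 's \<Rightarrow> 'b::{real_normed_field,euclidean_space}"
  assumes "(\<lambda>(t, s). f t s) \<in> borel_measurable (restrict_space borel T \<Otimes>\<^sub>M S)"
    and "\<And>t s. t \<in> T \<Longrightarrow> s \<in> space S \<Longrightarrow> norm (f t s) = 1"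
    and add: "\<And>t u s. t \<in> T \<Longrightarrow> u \<in> T \<Longrightarrow> s \<in> space S \<Longrightarrow> f (t + u) s = f t s * f u s"
  shows "preserving_generator T S f (\<lambda>t s. s) f"
proof -
  have "f t s = f t s * f 0 s" if "t \<in> T" "s \<in> space S" for t s
    using add[of t 0 s] that by simp
  then have "AE s in S. f t s = f t s * f 0 s" if "t \<in> T" for t
    using that by (intro AE_I2) blast
  then show ?thesis
    using assms
    by (simp add: preserving_generator_def measurable_flow_def flow_def unit_cocycle_def distr_id)
qed

section \<open>Disjoint unions of measure spaces\<close>

lemma vimage_Plus [simp]: "Inl -` (A <+> B) = A" "Inr -` (A <+> B) = B"
  by auto

lemma Plus_vimage: "Inl -` C <+> Inr -` C = C"
proof (intro equalityI subsetI)
  fix x assume "x \<in> C"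
  then show "x \<in> Inl -` C <+> Inr -` C" by (cases x) auto
qed auto

text \<open>A subset of the sum type is determined by its traces on the two summands, and taking
  traces commutes with complements and countable unions.\<close>

lemma sigma_algebra_Plus:
  "sigma_algebra (space S1 <+> space S2) {A <+> B | A B. A \<in> sets S1 \<and> B \<in> sets S2}"
    (is "sigma_algebra ?\<Omega> ?M")
proof -
  have M: "C \<in> ?M" if "Inl -` C \<in> sets S1" "Inr -` C \<in> sets S2" for C :: "('a + 'b) set"
    using that Plus_vimage[of C] by (intro CollectI exI[of _ "Inl -` C"] exI[of _ "Inr -` C"]) simp
  have M': "Inl -` C \<in> sets S1" "Inr -` C \<in> sets S2" if "C \<in> ?M" for C
    using that by auto
  show ?thesis
    unfolding sigma_algebra_iff2
  proof (intro conjI allI impI ballI)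
    show "?M \<subseteq> Pow ?\<Omega>"
    proof
      fix C assume "C \<in> ?M"
      then obtain A B where "C = A <+> B" "A \<in> sets S1" "B \<in> sets S2" by auto
      then show "C \<in> Pow ?\<Omega>"
        using sets.sets_into_space[of A S1] sets.sets_into_space[of B S2] by auto
    qed
    show "{} \<in> ?M" by (rule M) auto
    fix C assume C: "C \<in> ?M"
    show "?\<Omega> - C \<in> ?M"
      using M'[OF C] by (intro M) (simp_all add: vimage_Diff sets.compl_sets)
  next
    fix F :: "nat \<Rightarrow> ('a + 'b) set" assume F: "range F \<subseteq> ?M"
    have F': "F i \<in> ?M" for i
      using F by (rule range_subsetD)
    have "(\<Union>i. Inl -` F i) \<in> sets S1" "(\<Union>i. Inr -` F i) \<in> sets S2"
      using M'(1)[OF F'] M'(2)[OF F'] by (intro sets.countable_UN; simp add: image_subset_iff)+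
    then show "\<Union> (range F) \<in> ?M"
      by (intro M) (simp_all add: vimage_UN)
  qed
qed

lemma space_sum_measure: "space (S1 \<oplus>\<^sub>M S2) = space S1 <+> space S2"
  unfolding sum_measure_def by (simp add: sigma_algebra.space_measure_of_eq[OF sigma_algebra_Plus])

lemma sets_sum_measure: "sets (S1 \<oplus>\<^sub>M S2) = {A <+> B | A B. A \<in> sets S1 \<and> B \<in> sets S2}"
  unfolding sum_measure_def by (simp add: sigma_algebra.sets_measure_of_eq[OF sigma_algebra_Plus])

lemma sets_sum_measure_iff:
  "C \<in> sets (S1 \<oplus>\<^sub>M S2) \<longleftrightarrow> Inl -` C \<in> sets S1 \<and> Inr -` C \<in> sets S2"
proof
  assume "Inl -` C \<in> sets S1 \<and> Inr -` C \<in> sets S2"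
  then show "C \<in> sets (S1 \<oplus>\<^sub>M S2)"
    unfolding sets_sum_measure
    by (intro CollectI exI[of _ "Inl -` C"] exI[of _ "Inr -` C"]) (simp add: Plus_vimage)
qed (auto simp: sets_sum_measure)

text \<open>\<open>measure_of\<close> takes the prescribed values only once countable additivity is
  established; here it is inherited from the two summands by adding series termwise.\<close>

lemma emeasure_sum_measure:
  assumes C: "C \<in> sets (S1 \<oplus>\<^sub>M S2)"
  shows "emeasure (S1 \<oplus>\<^sub>M S2) C = emeasure S1 (Inl -` C) + emeasure S2 (Inr -` C)"
proof (rule emeasure_measure_of[OF sum_measure_def _ _ _ C])
  show "{A <+> B |A B. A \<in> sets S1 \<and> B \<in> sets S2} \<subseteq> Pow (space S1 <+> space S2)"
    using sigma_algebra_Plus[of S1 S2] by (simp add: sigma_algebra_iff2)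
  show "positive (sets (S1 \<oplus>\<^sub>M S2)) (\<lambda>C. emeasure S1 (Inl -` C) + emeasure S2 (Inr -` C))"
    by (simp add: positive_def)
  show "countably_additive (sets (S1 \<oplus>\<^sub>M S2)) (\<lambda>C. emeasure S1 (Inl -` C) + emeasure S2 (Inr -` C))"
  proof (rule countably_additiveI)
    fix F :: "nat \<Rightarrow> ('a + 'b) set"
    assume F: "range F \<subseteq> sets (S1 \<oplus>\<^sub>M S2)" and disj: "disjoint_family F"
    have "Inl -` F i \<in> sets S1" "Inr -` F i \<in> sets S2" for i
      using range_subsetD[OF F, of i] by (simp_all add: sets_sum_measure_iff)
    moreover have "disjoint_family (\<lambda>i. Inl -` F i)" "disjoint_family (\<lambda>i. Inr -` F i)"
      using disj by (auto simp: disjoint_family_on_def)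
    ultimately have "(\<Sum>i. emeasure S1 (Inl -` F i)) = emeasure S1 (\<Union>i. Inl -` F i)"
      "(\<Sum>i. emeasure S2 (Inr -` F i)) = emeasure S2 (\<Union>i. Inr -` F i)"
      by (auto intro!: suminf_emeasure)
    then show "(\<Sum>i. emeasure S1 (Inl -` F i) + emeasure S2 (Inr -` F i)) =
        emeasure S1 (Inl -` \<Union> (range F)) + emeasure S2 (Inr -` \<Union> (range F))"
      by (simp add: vimage_UN suminf_add[symmetric])
  qed
qed

lemma AE_sum_measure:
  assumes "AE s in S1. P (Inl s)" "AE s in S2. P (Inr s)"
  shows "AE s in S1 \<oplus>\<^sub>M S2. P s"
proof -
  obtain N1 where N1: "N1 \<in> null_sets S1" "{s \<in> space S1. \<not> P (Inl s)} \<subseteq> N1"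
    using assms(1) by (auto simp: eventually_ae_filter)
  obtain N2 where N2: "N2 \<in> null_sets S2" "{s \<in> space S2. \<not> P (Inr s)} \<subseteq> N2"
    using assms(2) by (auto simp: eventually_ae_filter)
  show ?thesis
  proof (rule AE_I')
    show "N1 <+> N2 \<in> null_sets (S1 \<oplus>\<^sub>M S2)"
      using N1(1) N2(1) by (auto simp: null_sets_def sets_sum_measure_iff emeasure_sum_measure)
    show "{s \<in> space (S1 \<oplus>\<^sub>M S2). \<not> P s} \<subseteq> N1 <+> N2"
      using N1(2) N2(2) by (auto simp: space_sum_measure)
  qed
qed

lemma measurable_Inl: "Inl \<in> S1 \<rightarrow>\<^sub>M S1 \<oplus>\<^sub>M S2"
  by (rule measurableI)
    (auto simp: space_sum_measure sets_sum_measure_iff intro: sets.Int)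

lemma measurable_Inr: "Inr \<in> S2 \<rightarrow>\<^sub>M S1 \<oplus>\<^sub>M S2"
  by (rule measurableI)
    (auto simp: space_sum_measure sets_sum_measure_iff intro: sets.Int)

text \<open>Measurability is tested on the two measurable pieces separately. \<open>projl\<close>
  and \<open>projr\<close> are meaningful only on their own summand, hence the restrictions.\<close>

lemma measurable_pair_sum_measure:
  assumes "(\<lambda>(r, s). g (r, Inl s)) \<in> R \<Otimes>\<^sub>M S1 \<rightarrow>\<^sub>M N" "(\<lambda>(r, s). g (r, Inr s)) \<in> R \<Otimes>\<^sub>M S2 \<rightarrow>\<^sub>M N"
  shows "g \<in> R \<Otimes>\<^sub>M (S1 \<oplus>\<^sub>M S2) \<rightarrow>\<^sub>M N"
proof -
  let ?S = "S1 \<oplus>\<^sub>M S2"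
  let ?L = "space R \<times> Inl ` space S1" and ?R = "space R \<times> Inr ` space S2"
  have sub: "Inl ` space S1 \<in> sets ?S" "Inr ` space S2 \<in> sets ?S"
    by (simp_all add: sets_sum_measure_iff inj_vimage_image_eq vimage_def image_iff)
  have projl: "projl \<in> restrict_space ?S (Inl ` space S1) \<rightarrow>\<^sub>M S1"
  proof (rule measurableI)
    fix A assume A: "A \<in> sets S1"
    have "projl -` A \<inter> space (restrict_space ?S (Inl ` space S1)) = A <+> {}"
      using sets.sets_into_space[OF A] by (auto simp: space_restrict_space space_sum_measure)
    moreover have "A <+> {} \<in> sets (restrict_space ?S (Inl ` space S1))"
      using sets.sets_into_space[OF A] A sub
      by (subst sets_restrict_space_iff) (auto simp: sets_sum_measure_iff)
    ultimately show "projl -` A \<inter> space (restrict_space ?S (Inl ` space S1))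
        \<in> sets (restrict_space ?S (Inl ` space S1))" by simp
  qed (auto simp: space_restrict_space)
  have projr: "projr \<in> restrict_space ?S (Inr ` space S2) \<rightarrow>\<^sub>M S2"
  proof (rule measurableI)
    fix A assume A: "A \<in> sets S2"
    have "projr -` A \<inter> space (restrict_space ?S (Inr ` space S2)) = {} <+> A"
      using sets.sets_into_space[OF A] by (auto simp: space_restrict_space space_sum_measure)
    moreover have "{} <+> A \<in> sets (restrict_space ?S (Inr ` space S2))"
      using sets.sets_into_space[OF A] A sub
      by (subst sets_restrict_space_iff) (auto simp: sets_sum_measure_iff)
    ultimately show "projr -` A \<inter> space (restrict_space ?S (Inr ` space S2))
        \<in> sets (restrict_space ?S (Inr ` space S2))" by simp
  qed (auto simp: space_restrict_space)
  have snd: "snd \<in> restrict_space (R \<Otimes>\<^sub>M ?S) (space R \<times> B) \<rightarrow>\<^sub>M restrict_space ?S B" for B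
    by (rule measurable_restrict_space2)
      (auto simp: space_restrict_space intro: measurable_restrict_space1)
  have fst: "fst \<in> restrict_space (R \<Otimes>\<^sub>M ?S) B \<rightarrow>\<^sub>M R" for B
    by (auto intro: measurable_restrict_space1)
  show ?thesis
  proof (rule measurable_piecewise_restrict[of "{?L, ?R}"])
    fix \<Omega> assume \<Omega>: "\<Omega> \<in> {?L, ?R}"
    show "\<Omega> \<inter> space (R \<Otimes>\<^sub>M ?S) \<in> sets (R \<Otimes>\<^sub>M ?S)"
      using \<Omega> sub by (auto intro!: sets.Int pair_measureI)
    have "g \<in> restrict_space (R \<Otimes>\<^sub>M ?S) ?L \<rightarrow>\<^sub>M N"
    proof (subst measurable_cong)
      show "(\<lambda>x. (\<lambda>(r, s). g (r, Inl s)) (fst x, projl (snd x))) \<in> restrict_space (R \<Otimes>\<^sub>M ?S) ?L \<rightarrow>\<^sub>M N"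
        by (rule measurable_compose[OF measurable_Pair[OF fst measurable_compose[OF snd projl]] assms(1)])
    qed (auto simp: space_restrict_space)
    moreover have "g \<in> restrict_space (R \<Otimes>\<^sub>M ?S) ?R \<rightarrow>\<^sub>M N"
    proof (subst measurable_cong)
      show "(\<lambda>x. (\<lambda>(r, s). g (r, Inr s)) (fst x, projr (snd x))) \<in> restrict_space (R \<Otimes>\<^sub>M ?S) ?R \<rightarrow>\<^sub>M N"
        by (rule measurable_compose[OF measurable_Pair[OF fst measurable_compose[OF snd projr]] assms(2)])
    qed (auto simp: space_restrict_space)
    ultimately show "g \<in> restrict_space (R \<Otimes>\<^sub>M ?S) \<Omega> \<rightarrow>\<^sub>M N"
      using \<Omega> by auto
  qed (auto simp: space_pair_measure space_sum_measure)
qed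

lemma distr_sum_measure:
  assumes f: "f \<in> S1 \<rightarrow>\<^sub>M S1" "distr S1 S1 f = S1" and g: "g \<in> S2 \<rightarrow>\<^sub>M S2" "distr S2 S2 g = S2"
    and fg: "map_sum f g \<in> S1 \<oplus>\<^sub>M S2 \<rightarrow>\<^sub>M S1 \<oplus>\<^sub>M S2"
  shows "distr (S1 \<oplus>\<^sub>M S2) (S1 \<oplus>\<^sub>M S2) (map_sum f g) = S1 \<oplus>\<^sub>M S2"
proof (rule measure_eqI)
  fix C assume "C \<in> sets (distr (S1 \<oplus>\<^sub>M S2) (S1 \<oplus>\<^sub>M S2) (map_sum f g))"
  then have C: "C \<in> sets (S1 \<oplus>\<^sub>M S2)" by simp
  have "Inl -` (map_sum f g -` C \<inter> space (S1 \<oplus>\<^sub>M S2)) = f -` (Inl -` C) \<inter> space S1"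
    "Inr -` (map_sum f g -` C \<inter> space (S1 \<oplus>\<^sub>M S2)) = g -` (Inr -` C) \<inter> space S2"
    by (auto simp: space_sum_measure)
  then have "emeasure (distr (S1 \<oplus>\<^sub>M S2) (S1 \<oplus>\<^sub>M S2) (map_sum f g)) C =
      emeasure (distr S1 S1 f) (Inl -` C) + emeasure (distr S2 S2 g) (Inr -` C)"
    using C f(1) g(1) measurable_sets[OF fg C]
    by (simp add: emeasure_distr[OF fg C] emeasure_sum_measure emeasure_distr sets_sum_measure_iff)
  then show "emeasure (distr (S1 \<oplus>\<^sub>M S2) (S1 \<oplus>\<^sub>M S2) (map_sum f g)) C = emeasure (S1 \<oplus>\<^sub>M S2) C"
    using C by (simp add: f(2) g(2) emeasure_sum_measure)
qed simp

text \<open>The combined flow never leaves a summand, so each condition can be checked on the two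
  summands in turn.\<close>

lemma (in index_set) preserving_generator_sum:
  fixes f1 :: "real \<Rightarrow> 's \<Rightarrow> 'b::{real_normed_field,euclidean_space}"
  assumes gen1: "preserving_generator T S1 f1 \<phi>1 a1" and gen2: "preserving_generator T S2 f2 \<phi>2 a2"
  shows "preserving_generator T (S1 \<oplus>\<^sub>M S2) (sum_kernel f1 f2)
    (\<lambda>t. map_sum (\<phi>1 t) (\<phi>2 t)) (\<lambda>t. case_sum (a1 t) (a2 t))"
proof -
  interpret A: time_flow T S1 \<phi>1
    by unfold_locales (use gen1 in \<open>simp add: preserving_generator_def\<close>)
  interpret B: time_flow T S2 \<phi>2
    by unfold_locales (use gen2 in \<open>simp add: preserving_generator_def\<close>)
  let ?\<phi> = "\<lambda>t. map_sum (\<phi>1 t) (\<phi>2 t)" and ?S = "S1 \<oplus>\<^sub>M S2" and ?R = "restrict_space borel T"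
  have "(\<lambda>(t, s). \<phi>1 t s) \<in> ?R \<Otimes>\<^sub>M S1 \<rightarrow>\<^sub>M S1" "(\<lambda>(t, s). \<phi>2 t s) \<in> ?R \<Otimes>\<^sub>M S2 \<rightarrow>\<^sub>M S2"
    using A.measurable_flow B.measurable_flow by (simp_all add: measurable_flow_def)
  from measurable_compose[OF this(1) measurable_Inl] measurable_compose[OF this(2) measurable_Inr]
  have "(\<lambda>(t, s). ?\<phi> t s) \<in> ?R \<Otimes>\<^sub>M ?S \<rightarrow>\<^sub>M ?S"
    by (intro measurable_pair_sum_measure) (simp_all add: split_beta')
  then have flow: "measurable_flow T ?S ?\<phi>"
    using A.in_space B.in_space A.add B.add
    by (auto simp: measurable_flow_def flow_def space_sum_measure)
  then interpret C: time_flow T ?S ?\<phi>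
    by unfold_locales
  have "distr ?S ?S (?\<phi> t) = ?S" if "t \<in> T" for t
    using gen1 gen2 that A.measurable_at B.measurable_at C.measurable_at
    by (intro distr_sum_measure) (simp_all add: preserving_generator_def)
  moreover have "unit_cocycle T ?S ?\<phi> (\<lambda>t. case_sum (a1 t) (a2 t))"
  proof -
    have c: "unit_cocycle T S1 \<phi>1 a1" "unit_cocycle T S2 \<phi>2 a2"
      using gen1 gen2 by (simp_all add: preserving_generator_def)
    then have "(\<lambda>(t, s). case_sum (a1 t) (a2 t) s) \<in> borel_measurable (?R \<Otimes>\<^sub>M ?S)"
      by (intro measurable_pair_sum_measure) (simp_all add: unit_cocycle_def split_beta')
    with c show ?thesis
      by (auto simp: unit_cocycle_def space_sum_measure)
  qed
  moreover have "AE s in ?S. sum_kernel f1 f2 t s = case_sum (a1 t) (a2 t) s * sum_kernel f1 f2 0 (?\<phi> t s)"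
    if "t \<in> T" for t
    using gen1 gen2 that
    by (intro AE_sum_measure) (simp_all add: preserving_generator_def sum_kernel_def)
  ultimately show ?thesis
    using flow by (simp add: preserving_generator_def)
qed

section \<open>The cyclic flow of a representation of type (II)\<close>

text \<open>The \<open>GREATEST\<close> operator is informative only when a maximum exists, which
  positivity of \<open>a\<close> ensures. The floor form also gives measurability.\<close>

lemma int_part_eq_floor:
  assumes "0 < a"
  shows "int_part a x = \<lfloor>x / a\<rfloor>"
  unfolding int_part_def
proof (rule Greatest_equality)
  show "of_int \<lfloor>x / a\<rfloor> * a \<le> x"
    using assms by (simp flip: pos_le_divide_eq)
  show "y \<le> \<lfloor>x / a\<rfloor>" if "of_int y * a \<le> x" for y
    using assms that by (simp add: le_floor_iff pos_le_divide_eq)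
qed

lemma int_part_unique:
  assumes "0 < a" "0 \<le> x - a * of_int n" "x - a * of_int n < a"
  shows "int_part a x = n"
  using assms by (simp add: int_part_eq_floor floor_eq_iff field_simps)

lemma frac_part_bounds:
  assumes "0 < a"
  shows "0 \<le> frac_part a x" "frac_part a x < a"
proof -
  show "0 \<le> frac_part a x" "frac_part a x < a"
    using floor_divide_lower[OF assms, of x] floor_divide_upper[OF assms, of x] assms
    by (simp_all add: frac_part_def int_part_eq_floor algebra_simps)
qed

lemma frac_part_unique:
  assumes "0 < a" "0 \<le> x - a * of_int n" "x - a * of_int n < a"
  shows "frac_part a x = x - a * of_int n"
  using int_part_unique[OF assms] by (simp add: frac_part_def)

text \<open>Dividing \<open>x\<close>, then its remainder plus \<open>t\<close>, leaves a remainder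
  in [0, a), so uniqueness of division identifies quotient and remainder of \<open>x + t\<close>.
  The quotients give the cocycle law, the remainders the flow law.\<close>

lemma int_part_frac_part_add:
  assumes "0 < a"
  shows "int_part a (x + t) = int_part a x + int_part a (frac_part a x + t)"
    and frac_part_frac_part_add: "frac_part a (frac_part a x + t) = frac_part a (x + t)"
proof -
  let ?n = "int_part a x + int_part a (frac_part a x + t)"
  have eq: "x + t - a * of_int ?n = frac_part a (frac_part a x + t)"
    by (simp add: frac_part_def algebra_simps)
  show int: "int_part a (x + t) = ?n"
    by (rule int_part_unique[OF assms]) (use frac_part_bounds[OF assms] in \<open>simp_all only: eq\<close>)
  show "frac_part a (frac_part a x + t) = frac_part a (x + t)"
    unfolding eq[symmetric] by (simp add: frac_part_def[of a "x + t"] int)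
qed

lemma int_part_eq_0: "0 \<le> x \<Longrightarrow> x < a \<Longrightarrow> int_part a x = 0"
  and frac_part_eq_self: "0 \<le> x \<Longrightarrow> x < a \<Longrightarrow> frac_part a x = x"
  using int_part_unique[of a x 0] frac_part_unique[of a x 0] by auto

text \<open>The exponent takes countably many values, so each fixed exponent may be treated
  alone.\<close>

lemma borel_measurable_power_int:
  fixes f :: "'s \<Rightarrow> 'b::{real_normed_field,euclidean_space}"
  assumes [measurable]: "f \<in> borel_measurable M" and n: "n \<in> M \<rightarrow>\<^sub>M count_space UNIV"
  shows "(\<lambda>x. f x powi n x) \<in> borel_measurable M"
proof (rule measurable_compose_countable[OF _ n])
  fix i :: int
  show "(\<lambda>x. f x powi i) \<in> borel_measurable M"
    by (cases "0 \<le> i") (simp_all add: power_int_def)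
qed

section \<open>Invariance of the time measure on [0, p) under rotation\<close>

context index_set
begin

lemma T_plus_in: "p \<in> T_plus T \<Longrightarrow> p \<in> T"
  and T_plus_pos: "p \<in> T_plus T \<Longrightarrow> 0 < p"
  using T_cases by (auto simp: T_plus_def split: if_splits)

lemma T_plus_sets: "T_plus T \<in> sets borel"
proof (cases "T = \<int>")
  case True
  have "{t \<in> \<int>. 2 \<le> t} \<in> sets (borel :: real measure)"
    by (rule sets.countable) (auto intro: countable_subset[OF _ countable_int])
  then show ?thesis
    using True by (simp add: T_plus_def)
qed (simp add: T_plus_def)

text \<open>Supplies the time that moves a point of a cycle. Over the integers it is 1, available
  because periods start at 2.\<close>

lemma T_plus_between:
  assumes "p \<in> T_plus T"
  obtains t where "t \<in> T" "0 < t" "t < p"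
proof (cases "T = \<int>")
  case True
  then show ?thesis
    using that[of 1] assms by (simp add: T_plus_def)
next
  case False
  then show ?thesis
    using that[of "p / 2"] assms T_cases by (simp add: T_plus_def)
qed

lemma int_mult_in: "p \<in> T \<Longrightarrow> p * of_int n \<in> T"
  using T_cases by auto

lemma frac_part_in: "p \<in> T \<Longrightarrow> x \<in> T \<Longrightarrow> frac_part p x \<in> T"
  unfolding frac_part_def by (intro diff_in int_mult_in)

lemma measurable_time_measure_iff:
  "f \<in> M \<rightarrow>\<^sub>M time_measure T \<longleftrightarrow> f \<in> borel_measurable M \<and> f \<in> space M \<rightarrow> T"
  unfolding measurable_cong_sets[OF refl sets_time_measure]
  by (rule measurable_restrict_space2_iff)

lemma emeasure_time_plus:
  assumes c: "c \<in> T" and B: "B \<in> sets (time_measure T)"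
  shows "(+) c -` B \<inter> T \<in> sets (time_measure T)"
    and "emeasure (time_measure T) ((+) c -` B \<inter> T) = emeasure (time_measure T) B"
  using measurable_sets[OF measurable_plus_time[OF c] B] distr_plus_time[OF c]
    emeasure_distr[OF measurable_plus_time[OF c] B]
  by (simp_all add: space_time_measure)

text \<open>Rotating by \<open>r = {t}\<^sub>p\<close> moves \<open>[0, p - r)\<close> to \<open>[r, p)\<close> and \<open>[p - r, p)\<close> to \<open>[0, r)\<close>.\<close>
lemma emeasure_rotation:
  assumes p: "p \<in> T_plus T" and t: "t \<in> T"
    and B: "B \<in> sets (time_measure T)" "B \<subseteq> {0..<p}"
  shows "emeasure (time_measure T) {v \<in> T. 0 \<le> v \<and> v < p \<and> frac_part p (v + t) \<in> B} =
    emeasure (time_measure T) B"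
proof -
  let ?\<tau> = "time_measure T"
  note pos = T_plus_pos[OF p] and pT = T_plus_in[OF p]
  \<comment> \<open>Only the remainder of \<open>t\<close> matters: adding \<open>t\<close> modulo
    \<open>p\<close> is adding \<open>r\<close>, with at most one wrap around.\<close>
  define r where "r = frac_part p t"
  have r: "0 \<le> r" "r < p" "r \<in> T"
    using frac_part_bounds[OF pos] frac_part_in[OF pT t] by (auto simp: r_def)
  have "(\<lambda>x. x) \<in> borel_measurable ?\<tau>"
    using measurable_time_measure_iff[of "\<lambda>x. x" ?\<tau>] by simp
  then have "(\<lambda>x. x) -` {..<r} \<inter> space ?\<tau> \<in> sets ?\<tau>"
    by (rule measurable_sets) simp
  from sets.Int[OF B(1) this] have B1: "B \<inter> {..<r} \<in> sets ?\<tau>"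
    by (rule back_subst[of "\<lambda>A. A \<in> sets ?\<tau>"]) (use sets.sets_into_space[OF B(1)] in auto)
  from sets.Diff[OF B(1) this] have B2: "B - {..<r} \<in> sets ?\<tau>"
    by (simp add: Diff_Int_distrib Diff_Int)
  have frac: "frac_part p (v + t) = (if v + r < p then v + r else v + r - p)"
    if "0 \<le> v" "v < p" for v
  proof -
    have "frac_part p (v + t) = frac_part p (r + v)"
      using frac_part_frac_part_add[OF pos, of t v] by (simp add: r_def add.commute)
    also have "\<dots> = (if v + r < p then v + r else v + r - p)"
      using frac_part_unique[OF pos, of "r + v" 0] frac_part_unique[OF pos, of "r + v" 1] r that
      by auto
    finally show ?thesis .
  qed
  \<comment> \<open>\<open>B\<close> lies in an interval of length \<open>p\<close>, so it cannot
    contain two points at distance \<open>p\<close>; the two preimages below are therefore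
    disjoint.\<close>
  have disj: "r - p + x \<notin> B" if "r + x \<in> B" for x
    using subsetD[OF B(2) that] subsetD[OF B(2), of "r - p + x"] by auto
  have split: "{v \<in> T. 0 \<le> v \<and> v < p \<and> frac_part p (v + t) \<in> B} =
      ((+) r -` (B - {..<r}) \<inter> T) \<union> ((+) (r - p) -` (B \<inter> {..<r}) \<inter> T)"
    using B(2) r by (auto simp: frac algebra_simps split: if_splits)
  have "emeasure ?\<tau> {v \<in> T. 0 \<le> v \<and> v < p \<and> frac_part p (v + t) \<in> B} =
      emeasure ?\<tau> ((+) r -` (B - {..<r}) \<inter> T) + emeasure ?\<tau> ((+) (r - p) -` (B \<inter> {..<r}) \<inter> T)"
    unfolding split using r pT disj
    by (intro plus_emeasure[symmetric] emeasure_time_plus B1 B2) auto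
  also have "\<dots> = emeasure ?\<tau> (B - {..<r}) + emeasure ?\<tau> (B \<inter> {..<r})"
    using emeasure_time_plus(2)[OF r(3) B2] emeasure_time_plus(2)[OF diff_in[OF r(3) pT] B1] by simp
  also have "\<dots> = emeasure ?\<tau> ((B - {..<r}) \<union> (B \<inter> {..<r}))"
    by (rule plus_emeasure[OF B2 B1]) auto
  also have "(B - {..<r}) \<union> (B \<inter> {..<r}) = B" by auto
  finally show ?thesis .
qed

end

text \<open>On the null set of \<open>z\<close> with \<open>q z \<notin> T\<^sub>+\<close> the flow is completed by the identity and the
  cocycle by 1.\<close>

definition rotation :: "real set \<Rightarrow> ('z \<Rightarrow> real) \<Rightarrow> real \<Rightarrow> 'z \<times> real \<Rightarrow> 'z \<times> real" where
  "rotation T q t = (\<lambda>(z, v). (z, if q z \<in> T_plus T then frac_part (q z) (v + t) else v))"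

definition rotation_cocycle ::
  "real set \<Rightarrow> ('z \<Rightarrow> real) \<Rightarrow> ('z \<Rightarrow> 'b::real_normed_field) \<Rightarrow> real \<Rightarrow> 'z \<times> real \<Rightarrow> 'b" where
  "rotation_cocycle T q b t =
    (\<lambda>(z, v). if q z \<in> T_plus T then b z powi int_part (q z) (v + t) else 1)"

section \<open>The rotation flow on the space of (II) and its cocycle\<close>

locale cyclic_space = index_set T + sigma_finite_measure \<sigma>
  for T and \<sigma> :: "'z measure" +
  fixes q :: "'z \<Rightarrow> real"
  assumes q [measurable]: "q \<in> borel_measurable \<sigma>"
    and AE_q: "AE z in \<sigma>. q z \<in> T_plus T"
begin

abbreviation "S \<equiv> space_II T \<sigma> q"
abbreviation "\<tau> \<equiv> time_measure T"
abbreviation "\<Omega> \<equiv> {(z, v). z \<in> space \<sigma> \<and> 0 \<le> v \<and> v < q z}"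

lemma measurable_id_time [measurable]: "(\<lambda>v. v) \<in> borel_measurable \<tau>"
  using measurable_time_measure_iff[of "\<lambda>x. x" \<tau>] by simp

lemma measurable_snd_time [measurable]: "snd \<in> borel_measurable (\<sigma> \<Otimes>\<^sub>M \<tau>)"
  by (rule measurable_compose[OF measurable_snd measurable_id_time])

lemma measurable_set_\<Omega>: "\<Omega> \<inter> space (\<sigma> \<Otimes>\<^sub>M \<tau>) \<in> sets (\<sigma> \<Otimes>\<^sub>M \<tau>)"
proof -
  have "\<Omega> \<inter> space (\<sigma> \<Otimes>\<^sub>M \<tau>) =
      {x \<in> space (\<sigma> \<Otimes>\<^sub>M \<tau>). 0 \<le> snd x \<and> snd x < q (fst x)}"
    by (auto simp: space_pair_measure)
  also have "\<dots> \<in> sets (\<sigma> \<Otimes>\<^sub>M \<tau>)" by measurable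
  finally show ?thesis .
qed

lemma space_II_eq: "space S = {(z, v). z \<in> space \<sigma> \<and> v \<in> T \<and> 0 \<le> v \<and> v < q z}"
  by (auto simp: space_II_def space_restrict_space space_pair_measure space_time_measure)

text \<open>The cylinder over a null set of \<open>z\<close> is null even when the time measure is
  infinite, because zero times infinity is zero in \<open>ennreal\<close>.\<close>

lemma AE_fst_T_plus: "AE s in S. q (fst s) \<in> T_plus T"
proof -
  obtain N where N: "N \<in> null_sets \<sigma>" "{z \<in> space \<sigma>. q z \<notin> T_plus T} \<subseteq> N"
    using AE_q by (auto simp: eventually_ae_filter)
  interpret \<tau>: sigma_finite_measure \<tau> by (rule sigma_finite_time_measure)
  have "AE s in \<sigma> \<Otimes>\<^sub>M \<tau>. q (fst s) \<in> T_plus T"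
  proof (rule AE_I')
    show "N \<times> space \<tau> \<in> null_sets (\<sigma> \<Otimes>\<^sub>M \<tau>)"
      using N(1) by (auto simp: null_sets_def \<tau>.emeasure_pair_measure_Times)
    show "{s \<in> space (\<sigma> \<Otimes>\<^sub>M \<tau>). q (fst s) \<notin> T_plus T} \<subseteq> N \<times> space \<tau>"
      using N(2) by (auto simp: space_pair_measure)
  qed
  then show ?thesis
    unfolding space_II_def AE_restrict_space_iff[OF measurable_set_\<Omega>] by eventually_elim simp
qed

text \<open>The \<sigma>-algebra on times is the trace of the Borel sets, so the second coordinate
  can be handled as an ordinary real function.\<close>

lemma measurable_into_S:
  assumes "(\<lambda>x. fst (f x)) \<in> M \<rightarrow>\<^sub>M \<sigma>" "(\<lambda>x. snd (f x)) \<in> borel_measurable M"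
    and "\<And>x. x \<in> space M \<Longrightarrow> f x \<in> space S"
  shows "f \<in> M \<rightarrow>\<^sub>M S"
  unfolding space_II_def
proof (rule measurable_restrict_space2)
  show "f \<in> space M \<rightarrow> \<Omega>"
  proof
    fix x assume "x \<in> space M"
    from assms(3)[OF this] show "f x \<in> \<Omega>" by (auto simp: space_II_eq)
  qed
  have "snd (f x) \<in> T" if "x \<in> space M" for x
    using assms(3)[OF that] by (auto simp: space_II_eq)
  then show "f \<in> M \<rightarrow>\<^sub>M \<sigma> \<Otimes>\<^sub>M \<tau>"
    using assms(1,2) by (auto simp: measurable_pair_iff comp_def measurable_time_measure_iff)
qed

lemma measurable_fst_S: "fst \<in> S \<rightarrow>\<^sub>M \<sigma>" and measurable_snd_S: "snd \<in> borel_measurable S"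
  unfolding space_II_def by (auto intro: measurable_restrict_space1)

abbreviation "R \<equiv> restrict_space borel T"

lemma measurable_time: "(\<lambda>x. x) \<in> borel_measurable R"
  by (rule measurable_restrict_space1) simp

lemma measurable_components:
  "(\<lambda>x. fst (snd x)) \<in> R \<Otimes>\<^sub>M S \<rightarrow>\<^sub>M \<sigma>"
  "(\<lambda>x. snd (snd x)) \<in> borel_measurable (R \<Otimes>\<^sub>M S)"
  "fst \<in> borel_measurable (R \<Otimes>\<^sub>M S)"
  using measurable_compose[OF measurable_snd measurable_fst_S]
    measurable_compose[OF measurable_snd measurable_snd_S]
    measurable_compose[OF measurable_fst measurable_time] .

lemma measurable_period: "(\<lambda>x. q (fst (snd x))) \<in> borel_measurable (R \<Otimes>\<^sub>M S)"
  by (rule measurable_compose[OF measurable_components(1) q])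

lemma sets_period: "{x \<in> space (R \<Otimes>\<^sub>M S). q (fst (snd x)) \<in> T_plus T} \<in> sets (R \<Otimes>\<^sub>M S)"
  using measurable_sets[OF measurable_period T_plus_sets] by (simp add: vimage_def Int_def conj_commute)

lemma measurable_floor_period:
  "(\<lambda>x. \<lfloor>(snd (snd x) + fst x) / q (fst (snd x))\<rfloor>) \<in> R \<Otimes>\<^sub>M S \<rightarrow>\<^sub>M count_space UNIV"
proof -
  note [measurable] = measurable_components(2,3) measurable_period
  show ?thesis by measurable
qed

lemma rotation_in_space: "t \<in> T \<Longrightarrow> s \<in> space S \<Longrightarrow> rotation T q t s \<in> space S"
  by (auto simp: space_II_eq rotation_def frac_part_bounds T_plus_pos frac_part_in T_plus_in)

lemma measurable_flow_rotation: "measurable_flow T S (rotation T q)"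
proof -
  \<comment> \<open>The second coordinate with \<open>int_part\<close> written as a floor, which is
    valid on the branch where the period is positive.\<close>
  have "(\<lambda>x. if q (fst (snd x)) \<in> T_plus T
      then snd (snd x) + fst x - q (fst (snd x)) * of_int \<lfloor>(snd (snd x) + fst x) / q (fst (snd x))\<rfloor>
      else snd (snd x)) \<in> borel_measurable (R \<Otimes>\<^sub>M S)"
    by (intro measurable_If[OF _ _ sets_period] borel_measurable_diff borel_measurable_add
        borel_measurable_times measurable_components measurable_period
        measurable_compose[OF measurable_floor_period]) simp
  also have "?this \<longleftrightarrow> (\<lambda>x. snd ((\<lambda>(t, s). rotation T q t s) x)) \<in> borel_measurable (R \<Otimes>\<^sub>M S)"
    by (intro measurable_cong)
      (auto simp: rotation_def frac_part_def int_part_eq_floor[OF T_plus_pos])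
  finally have "(\<lambda>(t, s). rotation T q t s) \<in> R \<Otimes>\<^sub>M S \<rightarrow>\<^sub>M S"
  proof (rule measurable_into_S[rotated])
    show "(\<lambda>x. fst ((\<lambda>(t, s). rotation T q t s) x)) \<in> R \<Otimes>\<^sub>M S \<rightarrow>\<^sub>M \<sigma>"
      using measurable_components(1) by (simp add: rotation_def split_beta')
    show "(\<lambda>(t, s). rotation T q t s) x \<in> space S" if "x \<in> space (R \<Otimes>\<^sub>M S)" for x
      using that rotation_in_space by (auto simp: space_pair_measure space_restrict_space)
  qed
  moreover have "rotation T q 0 s = s" if "s \<in> space S" for s
    using that by (auto simp: rotation_def space_II_eq frac_part_eq_self)
  moreover have "rotation T q (t1 + t2) s = rotation T q t1 (rotation T q t2 s)" for t1 t2 s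
    using frac_part_frac_part_add[OF T_plus_pos, of "q (fst s)" "snd s + t2" t1]
    by (simp add: rotation_def split_beta add.assoc add.commute[of t2 t1])
  ultimately show ?thesis
    by (simp add: measurable_flow_def flow_def rotation_in_space)
qed

sublocale rotation: time_flow T S "rotation T q"
  by unfold_locales (rule measurable_flow_rotation)

lemma emeasure_S:
  assumes A: "A \<in> sets S"
  shows "emeasure S A = (\<integral>\<^sup>+z. emeasure \<tau> (Pair z -` A) \<partial>\<sigma>)" "A \<in> sets (\<sigma> \<Otimes>\<^sub>M \<tau>)" "A \<subseteq> \<Omega>"
proof -
  interpret \<tau>: sigma_finite_measure \<tau> by (rule sigma_finite_time_measure)
  show A': "A \<in> sets (\<sigma> \<Otimes>\<^sub>M \<tau>)" "A \<subseteq> \<Omega>"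
    using A by (auto simp: space_II_def sets_restrict_space_iff[OF measurable_set_\<Omega>])
  then show "emeasure S A = (\<integral>\<^sup>+z. emeasure \<tau> (Pair z -` A) \<partial>\<sigma>)"
    by (simp add: space_II_def emeasure_restrict_space[OF measurable_set_\<Omega>] \<tau>.emeasure_pair_measure_alt)
qed

text \<open>The rotation keeps \<open>z\<close> fixed, so by Tonelli it suffices to compare
  sections: for an admissible period the section is rotated, otherwise it is unchanged.\<close>

lemma distr_rotation:
  assumes t: "t \<in> T"
  shows "distr S S (rotation T q t) = S"
proof (rule measure_eqI)
  fix A assume "A \<in> sets (distr S S (rotation T q t))"
  then have A: "A \<in> sets S" by simp
  let ?A = "rotation T q t -` A \<inter> space S"
  have A': "?A \<in> sets S"
    by (rule measurable_sets[OF rotation.measurable_at[OF t] A])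
  have "emeasure \<tau> (Pair z -` ?A) = emeasure \<tau> (Pair z -` A)" if z: "z \<in> space \<sigma>" for z
  proof (cases "q z \<in> T_plus T")
    case True
    have "Pair z -` ?A = {v \<in> T. 0 \<le> v \<and> v < q z \<and> frac_part (q z) (v + t) \<in> Pair z -` A}"
      using True z by (auto simp: rotation_def space_II_eq)
    moreover have "Pair z -` A \<in> sets \<tau>" "Pair z -` A \<subseteq> {0..<q z}"
      using emeasure_S(2,3)[OF A] by (auto intro: sets_Pair1)
    ultimately show ?thesis
      using emeasure_rotation[OF True t, of "Pair z -` A"] by simp
  next
    case False
    have "A \<subseteq> space S"
      by (rule sets.sets_into_space[OF A])
    with False have "Pair z -` ?A = Pair z -` A"
      by (auto simp: rotation_def)
    then show ?thesis by simp
  qed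
  then have "emeasure S ?A = emeasure S A"
    unfolding emeasure_S(1)[OF A] emeasure_S(1)[OF A'] by (rule nn_integral_cong)
  then show "emeasure (distr S S (rotation T q t)) A = emeasure S A"
    by (simp add: emeasure_distr[OF rotation.measurable_at[OF t] A])
qed simp

text \<open>The exponent counts completed turns: those up to time t1, plus those made from the
  rotated point during t2, give the total. Exponents then add because \<open>b z\<close>, having
  norm 1, is nonzero.\<close>

lemma unit_cocycle_rotation:
  fixes b :: "'z \<Rightarrow> 'b::{real_normed_field,euclidean_space}"
  assumes b: "b \<in> borel_measurable \<sigma>" "\<And>z. z \<in> space \<sigma> \<Longrightarrow> norm (b z) = 1"
  shows "unit_cocycle T S (rotation T q) (rotation_cocycle T q b)"
proof -
  have "(\<lambda>x. b (fst (snd x)) powi \<lfloor>(snd (snd x) + fst x) / q (fst (snd x))\<rfloor>)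
      \<in> borel_measurable (R \<Otimes>\<^sub>M S)"
    by (intro borel_measurable_power_int measurable_floor_period
        measurable_compose[OF measurable_components(1) b(1)])
  then have "(\<lambda>x. if q (fst (snd x)) \<in> T_plus T
      then b (fst (snd x)) powi \<lfloor>(snd (snd x) + fst x) / q (fst (snd x))\<rfloor> else 1)
      \<in> borel_measurable (R \<Otimes>\<^sub>M S)"
    by (intro measurable_If[OF _ _ sets_period]) simp_all
  also have "?this \<longleftrightarrow> (\<lambda>(t, s). rotation_cocycle T q b t s) \<in> borel_measurable (R \<Otimes>\<^sub>M S)"
    by (intro measurable_cong) (auto simp: rotation_cocycle_def int_part_eq_floor[OF T_plus_pos])
  finally have "(\<lambda>(t, s). rotation_cocycle T q b t s) \<in> borel_measurable (R \<Otimes>\<^sub>M S)" .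
  moreover have "norm (rotation_cocycle T q b t s) = 1" if "s \<in> space S" for t s
    using that b(2) by (auto simp: rotation_cocycle_def space_II_eq norm_power_int)
  moreover have "rotation_cocycle T q b (t1 + t2) s =
      rotation_cocycle T q b t1 s * rotation_cocycle T q b t2 (rotation T q t1 s)"
    if "s \<in> space S" for t1 t2 s
  proof -
    obtain z v where s: "s = (z, v)" by (cases s)
    then have "b z \<noteq> 0"
      using b(2)[of z] that by (auto simp: space_II_eq)
    moreover have "int_part (q z) (v + (t1 + t2)) =
        int_part (q z) (v + t1) + int_part (q z) (frac_part (q z) (v + t1) + t2)"
      if "q z \<in> T_plus T"
      using int_part_frac_part_add[OF T_plus_pos[OF that], of "v + t1" t2] by (simp add: add.assoc)
    ultimately show ?thesis
      by (simp add: s rotation_cocycle_def rotation_def power_int_add)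
  qed
  ultimately show ?thesis
    by (simp add: unit_cocycle_def)
qed

text \<open>A point of [0, q z) has completed no turn at time 0, so there the kernel is
  \<open>g\<close> itself, and the relation unfolds to the definition of
  \<open>kernel_II\<close>.\<close>

lemma preserving_generator_rotation:
  fixes b :: "'z \<Rightarrow> 'b::{real_normed_field,euclidean_space}"
  assumes "b \<in> borel_measurable \<sigma>" "\<And>z. z \<in> space \<sigma> \<Longrightarrow> norm (b z) = 1"
  shows "preserving_generator T S (kernel_II q b g) (rotation T q) (rotation_cocycle T q b)"
proof -
  have "AE s in S. kernel_II q b g t s = rotation_cocycle T q b t s * kernel_II q b g 0 (rotation T q t s)"
    for t
    using AE_fst_T_plus
  proof eventually_elim
    case (elim s)
    then show ?case
      using frac_part_bounds[OF T_plus_pos, of "q (fst s)" "snd s + t"]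
      by (auto simp: kernel_II_def rotation_def rotation_cocycle_def int_part_eq_0 frac_part_eq_self
          split_beta')
  qed
  then show ?thesis
    using unit_cocycle_rotation[OF assms]
    by (simp add: preserving_generator_def measurable_flow_rotation distr_rotation)
qed

text \<open>\<open>q z\<close> itself is a period, while a time strictly between 0 and
  \<open>q z\<close> sends \<open>v\<close> to \<open>v + t\<close> or \<open>v + t - q z\<close>,
  never back to \<open>v\<close>.\<close>

lemma cyclic_flow_rotation: "cyclic_flow T S (rotation T q)"
proof -
  have "AE s in S. s \<in> periodic_points T S (rotation T q) - fixed_points T S (rotation T q)"
    using AE_fst_T_plus AE_space
  proof eventually_elim
    case (elim s)
    obtain z v where s: "s = (z, v)" by (cases s)
    have p: "q z \<in> T_plus T" and v: "0 \<le> v" "v < q z"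
      using elim by (auto simp: s space_II_eq)
    note pos = T_plus_pos[OF p]
    have "rotation T q (q z) s = s"
      using frac_part_unique[OF pos, of "v + q z" 1] p v by (simp add: s rotation_def)
    then have "s \<in> periodic_points T S (rotation T q)"
      using elim(2) pos T_plus_in[OF p] by (auto simp: periodic_points_def)
    moreover obtain t where t: "t \<in> T" "0 < t" "t < q z"
      using T_plus_between[OF p] .
    have "frac_part (q z) (v + t) = (if v + t < q z then v + t else v + t - q z)"
      using frac_part_unique[OF pos, of "v + t" 0] frac_part_unique[OF pos, of "v + t" 1] v t by auto
    then have "rotation T q t s \<noteq> s"
      using t p by (simp add: s rotation_def)
    then have "s \<notin> fixed_points T S (rotation T q)"
      using t by (auto simp: fixed_points_def)
    ultimately show ?case by simp
  qed
  then show ?thesis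
    by (simp add: cyclic_flow_def measurable_flow_rotation)
qed

end

section \<open>Representations of type (I)\<close>

lemma sets_restrict_borel:
  assumes "D \<in> sets borel"
  shows "sets (restrict_space borel D) = sigma_sets D {U. openin (top_of_set D) U}"
proof -
  have "{U. openin (top_of_set D) U} = (\<inter>) D ` {U. open U}"
    by (auto simp: openin_open)
  moreover have "D \<in> sigma_sets UNIV {U. open U}"
    using assms by (simp add: borel_def)
  ultimately show ?thesis
    using sigma_sets_Int[of D UNIV "{U. open U}"] by (simp add: sets_restrict_space borel_def)
qed

lemma second_countable_euclidean:
  "second_countable (euclidean :: 'a::second_countable_topology topology)"
proof -
  obtain B :: "'a set set" where B: "countable B" "topological_basis B"
    using ex_countable_basis by blast
  have "\<exists>V\<in>B. x \<in> V \<and> V \<subseteq> U" if "open U" "x \<in> U" for U x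
    by (rule topological_basisE[OF B(2) that]) blast
  then show ?thesis
    unfolding second_countable_def
    using B topological_basis_open[OF B(2)] by (intro exI[of _ B]) auto
qed

lemma dual_set_sets: "dual_set T \<in> sets borel"
  by (simp add: dual_set_def)

text \<open>[0, 2 pi) is neither open nor closed in the line, but it is open in the closed
  half-line, and complete metrizability passes to closed and then to open subspaces.\<close>

lemma completely_metrizable_dual_set: "completely_metrizable_space (top_of_set (dual_set T))"
proof (cases "T = \<int>")
  case True
  have "completely_metrizable_space (top_of_set {0::real..})"
    by (intro completely_metrizable_space_closedin completely_metrizable_space_euclidean) simp
  then have "completely_metrizable_space (subtopology (top_of_set {0..}) ({0..} \<inter> {..<2 * pi}))"
    by (rule completely_metrizable_space_openin) (simp add: openin_open_Int)
  also have "subtopology (top_of_set {0..}) ({0..} \<inter> {..<2 * pi}) = top_of_set {0..<2 * pi}"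
    by (auto simp: subtopology_subtopology intro!: arg_cong[of _ _ "subtopology euclidean"])
  finally show ?thesis
    using True by (simp add: dual_set_def)
qed (simp add: dual_set_def completely_metrizable_space_euclidean)

lemma standard_borel_control_I_complex:
  assumes "control_I_complex T \<eta>"
  shows "standard_borel \<eta>"
proof -
  have sets: "sets \<eta> = sets (restrict_space borel (dual_set T))"
    using assms by (simp add: control_I_complex_def)
  then have space: "space \<eta> = dual_set T"
    using sets_eq_imp_space_eq[OF sets] by (simp add: space_restrict_space)
  have "second_countable (top_of_set (dual_set T))"
    by (intro second_countable_subtopology second_countable_euclidean)
  then show ?thesis
    unfolding standard_borel_def
    using completely_metrizable_dual_set sets_restrict_borel[OF dual_set_sets]
    by (intro exI[of _ "top_of_set (dual_set T)"]) (simp add: sets space)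
qed

lemma standard_borel_Pow:
  assumes "sets S = Pow A" "countable A"
  shows "standard_borel S"
proof -
  have "space S = A"
    using assms(1) sets.top[of S] sets.sets_into_space[of A S] by auto
  moreover have "Collect (openin (discrete_topology A)) = Pow A"
    by auto
  moreover have "sigma_sets A (Pow A) = Pow A"
    by (rule sigma_algebra.sigma_sets_eq[OF sigma_algebra_Pow])
  ultimately show ?thesis
    unfolding standard_borel_def using assms
    by (intro exI[of _ "discrete_topology A"])
      (simp add: completely_metrizable_space_discrete_topology second_countable_discrete_topology)
qed

text \<open>Dividing by \<open>f 0 = 1\<close> exhibits \<open>f u\<close> itself as a ratio, with
  no value at infinity.\<close>

lemma ratio_sigma_algebra_vimage:
  assumes "u \<in> T" "0 \<in> T" "\<And>s. s \<in> space S \<Longrightarrow> f 0 s = 1" "B \<in> sets borel"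
  shows "f u -` B \<inter> space S \<in> ratio_sigma_algebra T S f"
proof -
  have "f u -` B \<inter> space S = (\<lambda>s. extended_ratio (f u s) (f 0 s)) -` (Some ` B) \<inter> space S"
    using assms(3) by (auto simp: extended_ratio_def)
  moreover have "Some ` B \<in> extended_borel"
    using assms(4) by (simp add: extended_borel_def inj_vimage_image_eq)
  ultimately show ?thesis
    using assms(1,2) unfolding ratio_sigma_algebra_def by (intro sigma_sets.Basic) blast
qed

text \<open>Common frame for the real and complex kernels of (I): at each point, time acts through a
  character of \<open>T\<close> of norm 1. Finiteness of the measure makes these bounded functions
  integrable.\<close>

locale unitary_kernel = index_set T + finite_measure S
  for T and S :: "'s measure" +
  fixes f :: "real \<Rightarrow> 's \<Rightarrow> 'b::{real_normed_field,euclidean_space}"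
  assumes measurable_kernel: "(\<lambda>(t, s). f t s) \<in> borel_measurable (restrict_space borel T \<Otimes>\<^sub>M S)"
    and norm_kernel: "t \<in> T \<Longrightarrow> s \<in> space S \<Longrightarrow> norm (f t s) = 1"
    and kernel_add: "t \<in> T \<Longrightarrow> u \<in> T \<Longrightarrow> s \<in> space S \<Longrightarrow> f (t + u) s = f t s * f u s"
begin

lemma kernel_0: "s \<in> space S \<Longrightarrow> f 0 s = 1"
  using kernel_add[of 0 0 s] norm_kernel[of 0 s] by (auto simp: mult_cancel_left)

lemma representation_kernel:
  assumes "standard_borel S"
  shows "representation_kernel \<alpha> T S f"
proof -
  have "in_L \<alpha> S (f t)" if t: "t \<in> T" for t
  proof -
    have "f t \<in> borel_measurable S"
      using measurable_Pair2[OF measurable_kernel, of t] t by (simp add: space_restrict_space)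
    moreover have "integrable S (\<lambda>s. norm (f t s) powr \<alpha>) \<longleftrightarrow> integrable S (\<lambda>s. 1 :: real)"
      using norm_kernel[OF t] by (intro Bochner_Integration.integrable_cong) auto
    ultimately show ?thesis
      by (simp add: in_L_def)
  qed
  then show ?thesis
    using assms measurable_kernel sigma_finite_measure_axioms
    by (simp add: representation_kernel_def standard_lebesgue_def)
qed

text \<open>A single time suffices, since \<open>f 0 = 1\<close> vanishes nowhere.\<close>

lemma full_support: "full_support T S f"
proof -
  have "AE s in S. s \<in> B" if B: "\<forall>t\<in>T. AE s in S. s \<notin> B \<longrightarrow> f t s = 0" for B
    using bspec[OF B zero_in] AE_space by eventually_elim (auto simp: kernel_0)
  then have "is_support T S f (space S)"
    by (auto simp: is_support_def elim: eventually_mono)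
  then show ?thesis
    unfolding full_support_def by (intro exI[of _ "space S"]) simp
qed

text \<open>The ratio \<sigma>-algebra as a measurable space; only its sets matter. (M2) then
  amounts to recovering the point from functions measurable on \<open>G\<close>.\<close>

abbreviation "G \<equiv> sigma (space S) (ratio_sigma_algebra T S f)"

lemma sets_G: "sets G = ratio_sigma_algebra T S f"
  unfolding ratio_sigma_algebra_def
  by (intro sigma_algebra.sets_measure_of_eq sigma_algebra_sigma_sets) auto

lemma measurable_G: "u \<in> T \<Longrightarrow> f u \<in> borel_measurable G"
  using ratio_sigma_algebra_vimage[of u T S f] kernel_0
  by (intro measurableI) (simp_all add: sets_G space_measure_of_conv)

lemma minimal_kernelI: "sets S \<subseteq> sets G \<Longrightarrow> minimal_kernel T S f"
  using full_support unfolding minimal_kernel_def sets_G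
  by (auto intro!: bexI[of _ "_ :: 's set"])

end

section \<open>The complex and real kernels of (I) as characters\<close>

lemma (in index_set) unitary_kernel_I_complex:
  assumes "control_I_complex T \<eta>"
  shows "unitary_kernel T \<eta> kernel_I_complex"
proof -
  interpret finite_measure \<eta>
    using assms by (simp add: control_I_complex_def)
  have sets: "sets \<eta> = sets (restrict_space borel (dual_set T))"
    using assms by (simp add: control_I_complex_def)
  have "(\<lambda>x. x) \<in> borel_measurable \<eta>"
    unfolding measurable_cong_sets[OF sets refl] by (rule measurable_restrict_space1) simp
  moreover have "(\<lambda>x. x) \<in> borel_measurable (restrict_space borel T)"
    by (rule measurable_restrict_space1) simp
  ultimately have "(\<lambda>x. cis (fst x * snd x)) \<in> borel_measurable (restrict_space borel T \<Otimes>\<^sub>M \<eta>)"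
    by (intro borel_measurable_continuous_on[of cis] borel_measurable_times continuous_intros
        measurable_compose[OF measurable_fst] measurable_compose[OF measurable_snd])
  then show ?thesis
    by unfold_locales (simp_all add: kernel_I_complex_def split_beta' distrib_right cis_mult)
qed

text \<open>On integer times the floor is exact, so exponents add. On the line the space is {1},
  where the kernel is constantly 1.\<close>

lemma (in index_set) unitary_kernel_I_real:
  assumes "control_I_real T \<eta>"
  shows "unitary_kernel T \<eta> kernel_I_real"
proof -
  interpret finite_measure \<eta>
    using assms by (simp add: control_I_real_def)
  have sets: "sets \<eta> = Pow (if T = \<int> then {1, 2} else {1})"
    using assms by (simp add: control_I_real_def)
  then have space: "space \<eta> = (if T = \<int> then {1, 2} else {1})"
    using sets.top[of \<eta>] sets.sets_into_space[of "if T = \<int> then {1, 2} else {1}" \<eta>] by auto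
  let ?N = "restrict_space borel T \<Otimes>\<^sub>M \<eta>"
  have "(\<lambda>x. x) \<in> borel_measurable (restrict_space borel T)"
    by (rule measurable_restrict_space1) simp
  from measurable_compose[OF measurable_fst this]
  have "(\<lambda>x. \<lfloor>fst x\<rfloor>) \<in> ?N \<rightarrow>\<^sub>M count_space UNIV"
    by measurable
  then have "(\<lambda>x. (-1) powi \<lfloor>fst x\<rfloor> :: real) \<in> borel_measurable ?N"
    by (intro borel_measurable_power_int) simp_all
  moreover have "{x \<in> space ?N. snd x = 1} \<in> sets ?N"
    using measurable_sets[OF measurable_snd, of "{1}" \<eta> "restrict_space borel T"]
    by (simp add: sets vimage_def Int_def conj_commute)
  ultimately have "(\<lambda>x. if snd x = 1 then 1 else (-1) powi \<lfloor>fst x\<rfloor> :: real) \<in> borel_measurable ?N"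
    by (intro measurable_If) simp_all
  then show ?thesis
    by unfold_locales
      (auto simp: kernel_I_real_def split_beta' space norm_power_int power_int_add elim!: Ints_cases
        split: if_splits)
qed

section \<open>Minimality of (I)\<close>

lemma arccos_cos_of_nonneg_sin:
  assumes "0 \<le> x" "x < 2 * pi"
  shows "(if 0 \<le> sin x then arccos (cos x) else 2 * pi - arccos (cos x)) = x"
proof (cases "0 \<le> sin x")
  case True
  then have "x \<le> pi"
    using sin_lt_zero[of x] assms by force
  with True assms show ?thesis
    by (simp add: arccos_cos)
next
  case False
  then have "pi < x"
    using sin_ge_zero[of x] assms by force
  \<comment> \<open>Reflection at pi preserves the cosine and moves \<open>x\<close> into [0, pi],
    where \<open>arccos\<close> inverts \<open>cos\<close>.\<close>
  then have "arccos (cos (2 * pi - x)) = 2 * pi - x"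
    using assms by (intro arccos_cos) auto
  moreover have "cos (2 * pi - x) = cos x"
    by (simp add: cos_diff)
  ultimately show ?thesis
    using False by simp
qed

lemma (in index_set) minimal_kernel_I_complex:
  assumes \<eta>: "control_I_complex T \<eta>"
  shows "minimal_kernel T \<eta> kernel_I_complex"
proof -
  interpret unitary_kernel T \<eta> kernel_I_complex
    by (rule unitary_kernel_I_complex[OF \<eta>])
  have sets: "sets \<eta> = sets (restrict_space borel (dual_set T))"
    using \<eta> by (simp add: control_I_complex_def)
  then have space: "space \<eta> = dual_set T"
    using sets_eq_imp_space_eq[OF sets] by (simp add: space_restrict_space)
  have space_G: "space G = dual_set T"
    by (simp add: space_measure_of_conv space)
  have Re_Im: "(\<lambda>x. cos (t * x)) \<in> borel_measurable G" "(\<lambda>x. sin (t * x)) \<in> borel_measurable G"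
    if "t \<in> T" for t
    using borel_measurable_continuous_on[OF _ measurable_G[OF that], of Re]
      borel_measurable_continuous_on[OF _ measurable_G[OF that], of Im]
    by (simp_all add: kernel_I_complex_def continuous_intros)
  \<comment> \<open>Once the point is a measurable function on \<open>G\<close>, every Borel subset
    of the dual set lies in the ratio \<sigma>-algebra.\<close>
  have id: "(\<lambda>x. x) \<in> borel_measurable G"
  proof (cases "T = \<int>")
    case True
    \<comment> \<open>Clamping to [-1, 1] makes the composite with \<open>arccos\<close> continuous
      on the whole line; values of the cosine are unaffected.\<close>
    have arccos: "(\<lambda>x. arccos (max (-1) (min 1 x))) \<in> borel_measurable (borel :: real measure)"
      by (intro borel_measurable_continuous_onI continuous_intros) auto
    have cs: "(\<lambda>x. cos x) \<in> borel_measurable G" "(\<lambda>x. sin x) \<in> borel_measurable G"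
      using Re_Im[of 1] by simp_all
    have [measurable]: "(\<lambda>x. arccos (max (-1) (min 1 (cos x)))) \<in> borel_measurable G"
      by (rule measurable_compose[OF cs(1) arccos])
    have [measurable]: "Measurable.pred G (\<lambda>x. 0 \<le> sin x)"
      using cs(2) by measurable
    have "(\<lambda>x. if 0 \<le> sin x then arccos (max (-1) (min 1 (cos x)))
        else 2 * pi - arccos (max (-1) (min 1 (cos x)))) \<in> borel_measurable G"
      by measurable
    also have "?this \<longleftrightarrow> ?thesis"
    proof (rule measurable_cong)
      fix x assume "x \<in> space G"
      then have "0 \<le> x" "x < 2 * pi"
        unfolding space_G using True by (simp_all add: dual_set_def)
      from arccos_cos_of_nonneg_sin[OF this]
      show "(if 0 \<le> sin x then arccos (max (-1) (min 1 (cos x)))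
          else 2 * pi - arccos (max (-1) (min 1 (cos x)))) = x"
        by (simp split: if_splits)
    qed
    finally show ?thesis .
  next
    case False
    show ?thesis
    proof (rule borel_measurable_LIMSEQ_real)
      show "(\<lambda>x. sin (inverse (real (Suc n)) * x) / inverse (real (Suc n))) \<in> borel_measurable G" for n
        using False T_cases by (intro borel_measurable_divide Re_Im) auto
      fix x :: real
      \<comment> \<open>The measurable functions above are difference quotients at 0 of this
        function of \<open>h\<close>, whose derivative there is \<open>x\<close>. The times 1 / (n +
        1) are allowed because \<open>T\<close> is the whole line.\<close>
      have "((\<lambda>h. sin (h * x)) has_field_derivative x) (at 0)"
        by (auto intro!: derivative_eq_intros)
      then have "((\<lambda>h. sin (h * x) / h) \<longlongrightarrow> x) (at 0)"
        by (simp add: has_field_derivative_iff)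
      moreover have "filterlim (\<lambda>n. inverse (real (Suc n))) (at 0) sequentially"
        using LIMSEQ_inverse_real_of_nat by (simp add: filterlim_at)
      ultimately show "(\<lambda>n. sin (inverse (real (Suc n)) * x) / inverse (real (Suc n))) \<longlonglongrightarrow> x"
        by (rule filterlim_compose)
    qed
  qed
  show ?thesis
  proof (rule minimal_kernelI, rule subsetI)
    fix A assume "A \<in> sets \<eta>"
    then obtain B where "B \<in> sets borel" "A = dual_set T \<inter> B"
      by (auto simp: sets sets_restrict_space)
    then show "A \<in> sets G"
      using measurable_sets[OF id, of B] by (simp add: space_G Int_commute)
  qed
qed

lemma (in index_set) minimal_kernel_I_real:
  assumes \<eta>: "control_I_real T \<eta>"
  shows "minimal_kernel T \<eta> kernel_I_real"
proof -
  interpret unitary_kernel T \<eta> kernel_I_real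
    by (rule unitary_kernel_I_real[OF \<eta>])
  let ?A = "if T = \<int> then {1, 2} else {1} :: nat set"
  have sets: "sets \<eta> = Pow ?A"
    using \<eta> by (simp add: control_I_real_def)
  then have space: "space \<eta> = ?A"
    using sets.top[of \<eta>] sets.sets_into_space[of ?A \<eta>] by auto
  have space_G: "space G = ?A"
    by (simp add: space_measure_of_conv space)
  have singleton: "{k} \<in> sets G" if k: "k \<in> ?A" for k
  proof (cases "T = \<int>")
    case True
    \<comment> \<open>At time 1 the kernel takes the values 1 and -1 at the two points, so it
      separates them. On the line the one-point space is trivial.\<close>
    have "{k} = kernel_I_real 1 -` {kernel_I_real 1 k} \<inter> space G"
      unfolding space_G using True k by (auto simp: kernel_I_real_def)
    then show ?thesis
      using measurable_sets[OF measurable_G[OF one_in], of "{kernel_I_real 1 k}"] by simp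
  next
    case False
    then show ?thesis
      using k sets.top[of G] by (simp add: space_G)
  qed
  have "B \<in> sets G" if B: "B \<subseteq> ?A" for B
  proof (rule sets.countable[OF singleton countable_finite])
    show "finite B"
      using finite_subset[OF B] by simp
  qed (rule subsetD[OF B])
  then show ?thesis
    by (intro minimal_kernelI subsetI) (simp only: sets Pow_iff)
qed

section \<open>The generating flows\<close>

context index_set
begin

lemma cyclic_space_if_data_II:
  assumes "data_II \<alpha> T \<sigma> q b g"
  shows "cyclic_space T \<sigma> q"
  using assms by (simp add: data_II_def standard_lebesgue_def cyclic_space_def
      cyclic_space_axioms_def index_set_axioms)

text \<open>The remaining requirements on a generating flow are read off: integrability of
  \<open>f 0\<close> from the representation, full support from minimality.\<close>

lemma unique_flow_if_preserving_generator:
  assumes "stationary_process T P X" "sas_representation \<alpha> T S f Q M P X" "minimal_kernel T S f"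
    and gen: "preserving_generator T S f \<phi> a" and K: "K T S \<phi>"
    and "K \<in> {periodic_flow, identity_flow, cyclic_flow}"
  shows "generated_by_unique_flow K \<alpha> T S f Q M P X"
proof (rule generated_by_unique_flowI[OF assms(1-3) _ K assms(6)])
  have "representation_kernel \<alpha> T S f"
    using assms(2) by (simp add: sas_representation_def)
  then show "kernel_generated_by \<alpha> T S f \<phi>"
    using assms(3) by (intro preserving_generator_imp_generated[OF gen])
      (simp_all add: representation_kernel_def standard_lebesgue_def minimal_kernel_def)
qed

lemma unique_flow_I:
  assumes "unitary_kernel T S f" "stationary_process T P X"
    "sas_representation \<alpha> T S f Q M P X" "minimal_kernel T S f"
  shows "generated_by_unique_flow identity_flow \<alpha> T S f Q M P X"
proof -
  interpret unitary_kernel T S f by (rule assms(1))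
  have gen: "preserving_generator T S f (\<lambda>t s. s) f"
    using measurable_kernel norm_kernel kernel_add by (rule preserving_generator_identity)
  then have "identity_flow T S (\<lambda>t s. s)"
    by (auto simp: identity_flow_def preserving_generator_def fixed_points_def)
  then show ?thesis
    by (rule unique_flow_if_preserving_generator[OF assms(2-4) gen]) simp
qed

lemma unique_flow_II:
  assumes data: "data_II \<alpha> T \<sigma> q b g"
    and "stationary_process T P X" "sas_representation \<alpha> T (space_II T \<sigma> q) (kernel_II q b g) Q M P X"
      "minimal_kernel T (space_II T \<sigma> q) (kernel_II q b g)"
  shows "generated_by_unique_flow cyclic_flow \<alpha> T (space_II T \<sigma> q) (kernel_II q b g) Q M P X"
proof -
  interpret cyclic_space T \<sigma> q by (rule cyclic_space_if_data_II[OF data])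
  have "preserving_generator T S (kernel_II q b g) (rotation T q) (rotation_cocycle T q b)"
    using data by (intro preserving_generator_rotation) (simp_all add: data_II_def)
  from unique_flow_if_preserving_generator[where K = cyclic_flow, OF assms(2-4) this cyclic_flow_rotation]
  show ?thesis by simp
qed

text \<open>The flow rests on the first summand and rotates the second. Any nonzero time, here 1, is
  a period on the first; on the second, periodicity comes from the cyclic flow.\<close>

lemma unique_flow_I_II:
  assumes I: "unitary_kernel T S1 f1" and data: "data_II \<alpha> T \<sigma> q b g"
    and "stationary_process T P X"
      "sas_representation \<alpha> T (S1 \<oplus>\<^sub>M space_II T \<sigma> q) (sum_kernel f1 (kernel_II q b g)) Q M P X"
      "minimal_kernel T (S1 \<oplus>\<^sub>M space_II T \<sigma> q) (sum_kernel f1 (kernel_II q b g))"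
  shows "generated_by_unique_flow periodic_flow \<alpha> T
    (S1 \<oplus>\<^sub>M space_II T \<sigma> q) (sum_kernel f1 (kernel_II q b g)) Q M P X"
proof -
  interpret I: unitary_kernel T S1 f1 by (rule I)
  interpret cyclic_space T \<sigma> q by (rule cyclic_space_if_data_II[OF data])
  let ?\<phi> = "\<lambda>t. map_sum (\<lambda>s. s) (rotation T q t)"
  have "preserving_generator T S1 f1 (\<lambda>t s. s) f1"
    using I.measurable_kernel I.norm_kernel I.kernel_add by (rule preserving_generator_identity)
  moreover have "preserving_generator T S (kernel_II q b g) (rotation T q) (rotation_cocycle T q b)"
    using data by (intro preserving_generator_rotation) (simp_all add: data_II_def)
  ultimately have gen: "preserving_generator T (S1 \<oplus>\<^sub>M S) (sum_kernel f1 (kernel_II q b g))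
      ?\<phi> (\<lambda>t. case_sum (f1 t) (rotation_cocycle T q b t))"
    by (rule preserving_generator_sum)
  have "AE s in S1 \<oplus>\<^sub>M S. s \<in> periodic_points T (S1 \<oplus>\<^sub>M S) ?\<phi>"
  proof (rule AE_sum_measure)
    show "AE s in S1. Inl s \<in> periodic_points T (S1 \<oplus>\<^sub>M S) ?\<phi>"
      using AE_space by eventually_elim
        (auto simp: periodic_points_def space_sum_measure intro!: bexI[of _ 1])
    have "AE s in S. s \<in> periodic_points T S (rotation T q)"
      using cyclic_flow_rotation by (auto simp: cyclic_flow_def)
    then show "AE s in S. Inr s \<in> periodic_points T (S1 \<oplus>\<^sub>M S) ?\<phi>"
      by eventually_elim (auto simp: periodic_points_def space_sum_measure)
  qed
  with gen have "periodic_flow T (S1 \<oplus>\<^sub>M S) ?\<phi>"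
    by (simp add: periodic_flow_def preserving_generator_def)
  then show ?thesis
    by (rule unique_flow_if_preserving_generator[OF assms(3-5) gen]) simp
qed

end

theorem theorem3p2:
  fixes T :: "real set" and \<alpha> :: real and P :: "'p measure" and Q :: "'q measure"
  assumes "T = \<int> \<or> T = UNIV" and "0 < \<alpha>" and "\<alpha> < 2"
  shows
    \<comment> \<open>complex-valued case\<close>
    "(\<forall>\<eta> (\<sigma> :: 'z measure) q b g M X.
        control_I_complex T \<eta> \<and> data_II \<alpha> T \<sigma> q b g \<and> stationary_process T P X \<and>
        sas_representation \<alpha> T (\<eta> \<oplus>\<^sub>M space_II T \<sigma> q) (sum_kernel kernel_I_complex (kernel_II q b g)) Q M P X \<and>
        minimal_kernel T (\<eta> \<oplus>\<^sub>M space_II T \<sigma> q) (sum_kernel kernel_I_complex (kernel_II q b g)) \<longrightarrow>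
        generated_by_unique_flow periodic_flow \<alpha> T
          (\<eta> \<oplus>\<^sub>M space_II T \<sigma> q) (sum_kernel kernel_I_complex (kernel_II q b g)) Q M P X) \<and>
     (\<forall>\<eta> M X.
        control_I_complex T \<eta> \<and> stationary_process T P X \<and>
        sas_representation \<alpha> T \<eta> kernel_I_complex Q M P X \<and> minimal_kernel T \<eta> kernel_I_complex \<longrightarrow>
        generated_by_unique_flow identity_flow \<alpha> T \<eta> kernel_I_complex Q M P X) \<and>
     (\<forall>(\<sigma> :: 'z measure) q (b :: 'z \<Rightarrow> complex) g M X.
        data_II \<alpha> T \<sigma> q b g \<and> stationary_process T P X \<and>
        sas_representation \<alpha> T (space_II T \<sigma> q) (kernel_II q b g) Q M P X \<and>
        minimal_kernel T (space_II T \<sigma> q) (kernel_II q b g) \<longrightarrow>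
        generated_by_unique_flow cyclic_flow \<alpha> T (space_II T \<sigma> q) (kernel_II q b g) Q M P X) \<and>
     (\<forall>\<eta>. control_I_complex T \<eta> \<longrightarrow>
        representation_kernel \<alpha> T \<eta> kernel_I_complex \<and> minimal_kernel T \<eta> kernel_I_complex) \<and>
     \<comment> \<open>real-valued case\<close>
     (\<forall>\<eta> (\<sigma> :: 'z measure) q b g M X.
        control_I_real T \<eta> \<and> data_II \<alpha> T \<sigma> q b g \<and> stationary_process T P X \<and>
        sas_representation \<alpha> T (\<eta> \<oplus>\<^sub>M space_II T \<sigma> q) (sum_kernel kernel_I_real (kernel_II q b g)) Q M P X \<and>
        minimal_kernel T (\<eta> \<oplus>\<^sub>M space_II T \<sigma> q) (sum_kernel kernel_I_real (kernel_II q b g)) \<longrightarrow>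
        generated_by_unique_flow periodic_flow \<alpha> T
          (\<eta> \<oplus>\<^sub>M space_II T \<sigma> q) (sum_kernel kernel_I_real (kernel_II q b g)) Q M P X) \<and>
     (\<forall>\<eta> M X.
        control_I_real T \<eta> \<and> stationary_process T P X \<and>
        sas_representation \<alpha> T \<eta> kernel_I_real Q M P X \<and> minimal_kernel T \<eta> kernel_I_real \<longrightarrow>
        generated_by_unique_flow identity_flow \<alpha> T \<eta> kernel_I_real Q M P X) \<and>
     (\<forall>(\<sigma> :: 'z measure) q (b :: 'z \<Rightarrow> real) g M X.
        data_II \<alpha> T \<sigma> q b g \<and> stationary_process T P X \<and>
        sas_representation \<alpha> T (space_II T \<sigma> q) (kernel_II q b g) Q M P X \<and>
        minimal_kernel T (space_II T \<sigma> q) (kernel_II q b g) \<longrightarrow>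
        generated_by_unique_flow cyclic_flow \<alpha> T (space_II T \<sigma> q) (kernel_II q b g) Q M P X) \<and>
     (\<forall>\<eta>. control_I_real T \<eta> \<longrightarrow>
        representation_kernel \<alpha> T \<eta> kernel_I_real \<and> minimal_kernel T \<eta> kernel_I_real)"
proof -
  interpret index_set T
    by unfold_locales (rule assms(1))
  \<comment> \<open>That (I) is always minimal includes its being a representation kernel, so its
    space must be standard Borel: by the topology of the dual set in the complex case, by the
    discrete topology in the real case.\<close>
  have I_complex: "representation_kernel \<alpha> T \<eta> kernel_I_complex" if "control_I_complex T \<eta>" for \<eta>
    using that by (intro unitary_kernel.representation_kernel unitary_kernel_I_complex
        standard_borel_control_I_complex)
  have "standard_borel \<eta>" if "control_I_real T \<eta>" for \<eta>
    using that by (intro standard_borel_Pow[of \<eta> "if T = \<int> then {1, 2} else {1}"])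
      (auto simp: control_I_real_def)
  then have I_real: "representation_kernel \<alpha> T \<eta> kernel_I_real" if "control_I_real T \<eta>" for \<eta>
    using that by (intro unitary_kernel.representation_kernel unitary_kernel_I_real)
  show ?thesis
    by (intro conjI allI impI; (elim conjE)?)
      ((rule I_complex I_real minimal_kernel_I_complex minimal_kernel_I_real
        unique_flow_I_II[OF unitary_kernel_I_complex] unique_flow_I[OF unitary_kernel_I_complex]
        unique_flow_I_II[OF unitary_kernel_I_real] unique_flow_I[OF unitary_kernel_I_real]
        unique_flow_II; assumption)+)
qed

end
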